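(* Let $X$ be a compact manifold. Consider an almost-complex structure $J$ on $X$, viewed as a generalized-almost-complex structure $\mathcal{J}$ on $X$ (namely $\mathcal{J}=\mathcal{J}_J$). Then $\mathcal{J}$ is $\mathcal{C}^\infty$-pure-and-full if and only if $J$ is complex-$\mathcal{C}^\infty$-pure-and-full at every stage in the sense of Li and Zhang.
   Context: Let $X$ be a compact differentiable manifold (smooth, without boundary) of dimension $2n$. On $TX\oplus T^*X$ consider the symmetric pairing $\langle X+\xi\,|\,Y+\eta\rangle:=\frac12(\xi(Y)+\eta(X))$. A generalized-almost-complex structure is a $\langle\cdot|\cdot\rangle$-orthogonal endomorphism $\mathcal{J}$ of $TX\oplus T^*X$ with $\mathcal{J}^2=-\mathrm{id}$. An almost-complex structure $J\in\mathrm{End}(TX)$ induces the generalized-almost-complex structure $\mathcal{J}_J:=\begin{pmatrix}-J&0\\0&J^*\end{pmatrix}$, where $J^*\in\mathrm{End}(T^*X)$ is the dual endomorphism. Graduation on forms: $TX\oplus T^*X$ acts on differential forms by $(X+\xi)\cdot\varphi:=\iota_X\varphi+\xi\wedge\varphi$ (extended $\mathbb{C}$-bilinearly, inducing a Clifford action). Let $L\subset(TX\oplus T^*X)\otimes\mathbb{C}$ be the $i$-eigenbundle of $\mathcal{J}$ and let $U\subset\wedge^\bullet X\otimes\mathbb{C}$ be the complex line sub-bundle of (mixed-degree) complex forms locally generated by a form $\rho$ whose Clifford annihilator $\{v: v\cdot\rho=0\}$ is exactly $L$. For $k\in\mathbb{Z}$ set $U^k:=\wedge^{n-k}\bar L\cdot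 U\subseteq\wedge^\bullet X\otimes\mathbb{C}$; the same symbol denotes the space of smooth sections. For $\mathcal{J}=\mathcal{J}_J$ one has $U^k=\bigoplus_{p-q=k}\wedge^{p,q}_JX$. $GH_{dR}(X):=\ker d/\operatorname{im} d$ is the total complex de Rham cohomology of $X$ (mixed-degree complex forms), and $GH^{(k)}_{\mathcal{J}}(X)\subseteq GH_{dR}(X)$ is the subspace of classes that admit a $d$-closed representative in $U^k$. $\mathcal{J}$ is called $\mathcal{C}^\infty$-pure-and-full if the sum of these subspaces is direct and equals everything: $\bigoplus_{k\in\mathbb{Z}}GH^{(k)}_{\mathcal{J}}(X)=GH_{dR}(X)$. For $(p,q)\in\mathbb{Z}^2$, $H^{(p,q)}_J(X):=\{[\alpha]\in H^{p+q}_{dR}(X;\mathbb{C}) : \alpha\in\wedge^{p,q}_JX\}$ (classes admitting a $d$-closed representative of pure type $(p,q)$). $J$ is complex-$\mathcal{C}^\infty$-pure-and-full at the $k$th stage in the sense of Li and Zhang if $\bigoplus_{p+q=k}H^{(p,q)}_J(X)=H^k_{dR}(X;\mathbb{C})$ (the sum is direct and is everything); "at every stage" means for all $k\in\mathbb{Z}$. *)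

theory Defs
  imports
    "HOL-Analysis.Analysis"
    "HOL-Algebra.Module"
    "HOL-Library.Function_Algebras"
    "HOL-Library.Set_Algebras"
begin

section \<open>Smooth manifolds\<close>

primrec Ck_on :: "nat \<Rightarrow> 'a::real_normed_vector set \<Rightarrow> ('a \<Rightarrow> 'b::real_normed_vector) \<Rightarrow> bool" where
  "Ck_on 0 S f \<longleftrightarrow> continuous_on S f"
| "Ck_on (Suc k) S f \<longleftrightarrow>
     (\<forall>x\<in>S. f differentiable (at x)) \<and>
     (\<forall>v. Ck_on k S (\<lambda>x. frechet_derivative f (at x) v))"

text \<open>Only used for open sets in finite-dimensional spaces, where it is the usual notion.\<close>

definition smooth_on :: "'a::real_normed_vector set \<Rightarrow> ('a \<Rightarrow> 'b::real_normed_vector) \<Rightarrow> bool" where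
  "smooth_on S f \<longleftrightarrow> (\<forall>k. Ck_on k S f)"

lemma Ck_on_cong:
  assumes "open S" "\<And>x. x \<in> S \<Longrightarrow> f x = g x" "Ck_on k S f"
  shows "Ck_on k S g"
  using assms(2,3)
proof (induction k arbitrary: f g)
  case 0
  then show ?case by (metis Ck_on.simps(1) continuous_on_cong)
next
  case (Suc k)
  have d: "(g has_derivative frechet_derivative f (at x)) (at x)" if "x \<in> S" for x
    using Suc.prems that assms(1) has_derivative_transform_within_open
    by (metis Ck_on.simps(2) frechet_derivative_works)
  then have e: "frechet_derivative f (at x) = frechet_derivative g (at x)" if "x \<in> S" for x
    using frechet_derivative_at that by blast
  have "Ck_on k S (\<lambda>x. frechet_derivative g (at x) v)" for v
  proof (rule Suc.IH)
    show "frechet_derivative f (at x) v = frechet_derivative g (at x) v" if "x \<in> S" for x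
      using e[OF that] by simp
    show "Ck_on k S (\<lambda>x. frechet_derivative f (at x) v)"
      using Suc.prems by simp
  qed
  with d show ?case by (auto simp: differentiable_def)
qed

lemma Ck_on_bounded_linear:
  assumes "open S" "bounded_linear h" "Ck_on k S f"
  shows "Ck_on k S (\<lambda>x. h (f x))"
  using assms(3)
proof (induction k arbitrary: f)
  case 0
  then show ?case using bounded_linear.continuous_on[OF assms(2)] by simp
next
  case (Suc k)
  have d: "((\<lambda>x. h (f x)) has_derivative (\<lambda>v. h (frechet_derivative f (at x) v))) (at x)"
    if "x \<in> S" for x
  proof -
    have "f differentiable (at x)" using Suc.prems that by simp
    then show ?thesis
      by (intro bounded_linear.has_derivative[OF assms(2)]) (simp add: frechet_derivative_works)
  qed
  have "Ck_on k S (\<lambda>x. frechet_derivative (\<lambda>x. h (f x)) (at x) v)" for v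
  proof (rule Ck_on_cong[OF assms(1)])
    show "h (frechet_derivative f (at x) v) = frechet_derivative (\<lambda>x. h (f x)) (at x) v"
      if "x \<in> S" for x
      using fun_cong[OF frechet_derivative_at[OF d[OF that]], of v] .
    show "Ck_on k S (\<lambda>x. h (frechet_derivative f (at x) v))"
      using Suc.prems by (intro Suc.IH) simp
  qed
  with d show ?case by (auto simp: differentiable_def)
qed

type_synonym ('a, 'e) chart = "'a set \<times> ('a \<Rightarrow> 'e)"

definition chart_image :: "('a, 'e) chart \<Rightarrow> 'e set" where
  "chart_image c = snd c ` fst c"

definition overlap :: "('a, 'e) chart \<Rightarrow> ('a, 'e) chart \<Rightarrow> 'e set" where
  "overlap c c' = snd c ` (fst c \<inter> fst c')"

definition transition :: "('a, 'e) chart \<Rightarrow> ('a, 'e) chart \<Rightarrow> 'e \<Rightarrow> 'e" where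
  "transition c c' = snd c' \<circ> inv_into (fst c) (snd c)"

text \<open>
  The model space is a finite-dimensional inner product space given by a basis, instead of a type
  of class \<^class>\<open>euclidean_space\<close>, because the latter class excludes dimension 0.
  The atlas need not be maximal: tensor fields below are determined by, and can be freely
  prescribed through, compatible local representatives in any atlas of the smooth structure.
\<close>

definition smooth_manifold ::
  "'a topology \<Rightarrow> ('a, 'e::real_inner) chart set \<Rightarrow> nat \<Rightarrow> bool" where
  "smooth_manifold X A m \<longleftrightarrow>
     (\<exists>B::'e set. finite B \<and> independent B \<and> span B = UNIV \<and> card B = m) \<and>
     Hausdorff_space X \<and> second_countable X \<and>
     (\<forall>c\<in>A. openin X (fst c) \<and> open (chart_image c) \<and>
        homeomorphic_map (subtopology X (fst c)) (top_of_set (chart_image c)) (snd c)) \<and>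
     \<Union> (fst ` A) = topspace X \<and>
     (\<forall>c\<in>A. \<forall>c'\<in>A. smooth_on (overlap c c') (transition c c'))"

definition dtransition ::
  "('a, 'e::real_normed_vector) chart \<Rightarrow> ('a, 'e) chart \<Rightarrow> 'e \<Rightarrow> 'e \<Rightarrow>\<^sub>L 'e" where
  "dtransition c c' x = Blinfun (frechet_derivative (transition c c') (at x))"

section \<open>Almost-complex and generalized-almost-complex structures\<close>

text \<open>
  A section of a bundle built from the tangent bundle is a family of local representatives: to a
  chart \<open>c\<close> and a point \<open>x\<close> of its image belongs the value in the trivialization induced by \<open>c\<close>.
  Representatives in different charts are related by the derivatives of the transition maps.
\<close>

definition almost_complex_structure ::
  "('a, 'e::real_inner) chart set \<Rightarrow> (('a, 'e) chart \<Rightarrow> 'e \<Rightarrow> 'e \<Rightarrow>\<^sub>L 'e) \<Rightarrow> bool" where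
  "almost_complex_structure A J \<longleftrightarrow>
     (\<forall>c\<in>A. smooth_on (chart_image c) (J c)) \<and>
     (\<forall>c\<in>A. \<forall>x\<in>chart_image c. J c x o\<^sub>L J c x = - id_blinfun) \<and>
     (\<forall>c\<in>A. \<forall>c'\<in>A. \<forall>x\<in>overlap c c'.
        dtransition c c' x o\<^sub>L J c x = J c' (transition c c' x) o\<^sub>L dtransition c c' x)"

text \<open>The fibre of \<open>TX \<oplus> T\<^sup>*X\<close> in a chart.\<close>

type_synonym 'e gtangent = "'e \<times> ('e \<Rightarrow>\<^sub>L real)"

definition gpairing :: "'e::real_normed_vector gtangent \<Rightarrow> 'e gtangent \<Rightarrow> real" where
  "gpairing a b = (blinfun_apply (snd a) (fst b) + blinfun_apply (snd b) (fst a)) / 2"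

text \<open>Vectors are pushed forward; covectors are pulled back along the inverse transition.\<close>

definition gtransition ::
  "('a, 'e::real_normed_vector) chart \<Rightarrow> ('a, 'e) chart \<Rightarrow> 'e \<Rightarrow> 'e gtangent \<Rightarrow> 'e gtangent" where
  "gtransition c c' x a =
     (dtransition c c' x (fst a), snd a o\<^sub>L dtransition c' c (transition c c' x))"

definition generalized_almost_complex_structure ::
  "('a, 'e::real_inner) chart set \<Rightarrow>
   (('a, 'e) chart \<Rightarrow> 'e \<Rightarrow> 'e gtangent \<Rightarrow>\<^sub>L 'e gtangent) \<Rightarrow> bool" where
  "generalized_almost_complex_structure A JJ \<longleftrightarrow>
     (\<forall>c\<in>A. smooth_on (chart_image c) (JJ c)) \<and>
     (\<forall>c\<in>A. \<forall>x\<in>chart_image c. \<forall>a b. gpairing (JJ c x a) (JJ c x b) = gpairing a b) \<and>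
     (\<forall>c\<in>A. \<forall>x\<in>chart_image c. JJ c x o\<^sub>L JJ c x = - id_blinfun) \<and>
     (\<forall>c\<in>A. \<forall>c'\<in>A. \<forall>x\<in>overlap c c'. \<forall>a.
        gtransition c c' x (JJ c x a) = JJ c' (transition c c' x) (gtransition c c' x a))"

text \<open>The block matrix with diagonal entries \<open>-J\<close> and \<open>J\<^sup>*\<close>, where \<open>J\<^sup>* \<xi> = \<xi> \<circ> J\<close>.\<close>

definition gacs_fibre :: "('e::real_normed_vector \<Rightarrow>\<^sub>L 'e) \<Rightarrow> 'e gtangent \<Rightarrow>\<^sub>L 'e gtangent" where
  "gacs_fibre J = Blinfun (\<lambda>(v, \<xi>). (- blinfun_apply J v, \<xi> o\<^sub>L J))"

definition gacs_of ::
  "(('a, 'e::real_normed_vector) chart \<Rightarrow> 'e \<Rightarrow> 'e \<Rightarrow>\<^sub>L 'e) \<Rightarrow>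
   ('a, 'e) chart \<Rightarrow> 'e \<Rightarrow> 'e gtangent \<Rightarrow>\<^sub>L 'e gtangent" where
  "gacs_of J c x = gacs_fibre (J c x)"

lemma bounded_linear_gacs_fibre_aux:
  "bounded_linear (\<lambda>a :: 'e::real_normed_vector gtangent.
     (- blinfun_apply J (fst a), snd a o\<^sub>L J))"
  by (intro bounded_linear_Pair bounded_linear_minus bounded_linear_compose[OF blinfun.bounded_linear_right]
      bounded_linear_fst bounded_linear_compose[OF bounded_bilinear.bounded_linear_left[OF
        bounded_bilinear_blinfun_compose]] bounded_linear_snd)

lemma gacs_fibre_apply:
  "blinfun_apply (gacs_fibre J) (v, \<xi>) = (- blinfun_apply J v, \<xi> o\<^sub>L J)"
  using bounded_linear_Blinfun_apply[OF bounded_linear_gacs_fibre_aux[of J]]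
  by (simp add: gacs_fibre_def case_prod_unfold)

lemma bounded_linear_gacs_fibre: "bounded_linear gacs_fibre"
proof (rule bounded_linear_intro[where K = 2])
  fix J K :: "'e::real_normed_vector \<Rightarrow>\<^sub>L 'e" and r :: real
  show "gacs_fibre (J + K) = gacs_fibre J + gacs_fibre K"
    by (rule blinfun_eqI) (auto simp: gacs_fibre_apply blinfun.add_left
        bounded_bilinear.add_right[OF bounded_bilinear_blinfun_compose])
  show "gacs_fibre (r *\<^sub>R J) = r *\<^sub>R gacs_fibre J"
    by (rule blinfun_eqI) (auto simp: gacs_fibre_apply blinfun.scaleR_left
        bounded_bilinear.scaleR_right[OF bounded_bilinear_blinfun_compose])
  show "norm (gacs_fibre J) \<le> norm J * 2"
  proof (rule norm_blinfun_bound)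
    fix a :: "'e gtangent"
    obtain v \<xi> where a: "a = (v, \<xi>)" by force
    have "norm (blinfun_apply (gacs_fibre J) a) \<le> norm (- blinfun_apply J v) + norm (\<xi> o\<^sub>L J)"
      unfolding a gacs_fibre_apply by (rule norm_Pair_le)
    also have "\<dots> \<le> norm J * norm v + norm \<xi> * norm J"
      using norm_blinfun[of J v] norm_blinfun_compose[of \<xi> J] by simp
    also have "\<dots> \<le> norm J * norm a + norm a * norm J"
      unfolding a by (intro add_mono mult_left_mono mult_right_mono norm_fst_le norm_snd_le) auto
    finally show "norm (blinfun_apply (gacs_fibre J) a) \<le> norm J * 2 * norm a"
      by (simp add: mult_ac)
  qed auto
qed

lemma generalized_almost_complex_structure_gacs_of:
  assumes "smooth_manifold X A m" and "almost_complex_structure A J"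
  shows "generalized_almost_complex_structure A (gacs_of J)"
  unfolding generalized_almost_complex_structure_def
proof (intro conjI ballI allI)
  fix c assume c: "c \<in> A"
  have "open (chart_image c)" using assms(1) c by (auto simp: smooth_manifold_def)
  then show "smooth_on (chart_image c) (gacs_of J c)"
    using assms(2) c unfolding smooth_on_def gacs_of_def almost_complex_structure_def
    by (auto intro: Ck_on_bounded_linear[OF _ bounded_linear_gacs_fibre])
next
  fix c x assume c: "c \<in> A" "x \<in> chart_image c"
  have "J c x o\<^sub>L J c x = - id_blinfun"
    using assms(2) c by (auto simp: almost_complex_structure_def)
  then have J2: "blinfun_apply (J c x) (blinfun_apply (J c x) v) = - v" for v
    by (metis blinfun_apply_blinfun_compose blinfun.minus_left id_blinfun.rep_eq id_apply)
  show "gpairing (gacs_of J c x a) (gacs_of J c x b) = gpairing a b" for a b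
    by (cases a; cases b)
       (simp add: gacs_of_def gacs_fibre_apply gpairing_def J2 blinfun.minus_right)
  show "gacs_of J c x o\<^sub>L gacs_of J c x = - id_blinfun"
    by (rule blinfun_eqI)
       (auto simp: gacs_of_def gacs_fibre_apply J2 blinfun.minus_right blinfun.minus_left
        intro!: blinfun_eqI)
next
  fix c c' x a assume c: "c \<in> A" "c' \<in> A" "x \<in> overlap c c'"
  let ?x = "transition c c' x"
  have inj_chart: "inj_on (snd b) (fst b)" if "b \<in> A" for b
  proof -
    have "openin X (fst b)"
      and "homeomorphic_map (subtopology X (fst b)) (top_of_set (chart_image b)) (snd b)"
      using assms(1) that unfolding smooth_manifold_def by blast+
    then show ?thesis
      using homeomorphic_imp_injective_map topspace_subtopology_subset[OF openin_subset]
      by metis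
  qed
  note inj = inj_chart[OF c(1)] inj_chart[OF c(2)]
  obtain p where p: "p \<in> fst c" "p \<in> fst c'" "x = snd c p"
    using c(3) by (auto simp: overlap_def)
  have x': "?x = snd c' p" using p inj by (simp add: transition_def)
  then have o: "?x \<in> overlap c' c" using p by (auto simp: overlap_def)
  have x: "transition c' c ?x = x" using p inj x' by (simp add: transition_def)
  have 1: "dtransition c c' x o\<^sub>L J c x = J c' ?x o\<^sub>L dtransition c c' x"
    using assms(2) c by (simp add: almost_complex_structure_def)
  have 2: "dtransition c' c ?x o\<^sub>L J c' ?x = J c x o\<^sub>L dtransition c' c ?x"
    using assms(2) c o x by (metis almost_complex_structure_def)
  show "gtransition c c' x (gacs_of J c x a) = gacs_of J c' ?x (gtransition c c' x a)"
  proof (cases a)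
    case (Pair v \<xi>)
    have "blinfun_apply (dtransition c c' x) (blinfun_apply (J c x) v) =
          blinfun_apply (J c' ?x) (blinfun_apply (dtransition c c' x) v)"
      using 1 by (metis blinfun_apply_blinfun_compose)
    moreover have "blinfun_apply (J c x) (blinfun_apply (dtransition c' c ?x) w) =
          blinfun_apply (dtransition c' c ?x) (blinfun_apply (J c' ?x) w)" for w
      using 2 by (metis blinfun_apply_blinfun_compose)
    ultimately show ?thesis
      by (auto simp: Pair gtransition_def gacs_of_def gacs_fibre_apply blinfun.minus_right
          intro!: blinfun_eqI)
  qed
qed

section \<open>The complex exterior algebra of a fibre\<close>

text \<open>
  A mixed-degree complex form is a function on lists of vectors; its restriction to the lists of
  length \<open>k\<close> is its component of degree \<open>k\<close>.
\<close>

type_synonym 'e mform = "'e list \<Rightarrow> complex"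

definition alternating :: "'e::real_vector mform \<Rightarrow> bool" where
  "alternating \<phi> \<longleftrightarrow>
     (\<forall>us ws. linear (\<lambda>v. \<phi> (us @ v # ws))) \<and> (\<forall>vs. \<not> distinct vs \<longrightarrow> \<phi> vs = 0)"

definition cspan :: "'e mform set \<Rightarrow> 'e mform set" where
  "cspan = module.span (\<lambda>z \<phi> vs. z * \<phi> vs)"

definition omit_nth :: "nat \<Rightarrow> 'b list \<Rightarrow> 'b list" where
  "omit_nth i vs = take i vs @ drop (Suc i) vs"

definition interior_product :: "'e \<Rightarrow> 'e mform \<Rightarrow> 'e mform" where
  "interior_product v \<phi> vs = \<phi> (v # vs)"

definition covector_wedge :: "('e \<Rightarrow> complex) \<Rightarrow> 'e mform \<Rightarrow> 'e mform" where
  "covector_wedge \<xi> \<phi> vs = (\<Sum>i<length vs. (-1) ^ i * \<xi> (vs ! i) * \<phi> (omit_nth i vs))"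

definition unit_form :: "'e mform" where
  "unit_form vs = (if vs = [] then 1 else 0)"

text \<open>A pair \<open>(a, b)\<close> stands for the element \<open>a + \<i>b\<close> of the complexification.\<close>

type_synonym 'v complexified = "'v \<times> 'v"

definition cconj :: "'v::uminus complexified \<Rightarrow> 'v complexified" where
  "cconj w = (fst w, - snd w)"

definition real_clifford :: "'e::real_normed_vector gtangent \<Rightarrow> 'e mform \<Rightarrow> 'e mform" where
  "real_clifford a \<phi> =
     interior_product (fst a) \<phi> + covector_wedge (\<lambda>v. complex_of_real (snd a v)) \<phi>"

definition clifford :: "'e::real_normed_vector gtangent complexified \<Rightarrow> 'e mform \<Rightarrow> 'e mform" where
  "clifford w \<phi> = (\<lambda>vs. real_clifford (fst w) \<phi> vs + \<i> * real_clifford (snd w) \<phi> vs)"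

text \<open>Here \<open>a + \<i>b\<close> satisfies \<open>T (a + \<i>b) = \<i>(a + \<i>b)\<close> for the complexified operator \<open>T\<close>.\<close>

definition i_eigenspace ::
  "('e::real_normed_vector gtangent \<Rightarrow>\<^sub>L 'e gtangent) \<Rightarrow> 'e gtangent complexified set" where
  "i_eigenspace T = {(a, b). T a = - b \<and> T b = a}"

definition annihilator :: "'e::real_normed_vector mform \<Rightarrow> 'e gtangent complexified set" where
  "annihilator \<rho> = {w. clifford w \<rho> = 0}"

definition canonical_line ::
  "('e::real_normed_vector gtangent \<Rightarrow>\<^sub>L 'e gtangent) \<Rightarrow> 'e mform set" where
  "canonical_line T = cspan {\<rho>. alternating \<rho> \<and> annihilator \<rho> = i_eigenspace T}"

text \<open>
  As the conjugate of the eigenspace is isotropic, its elements anticommute under the Clifford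
  action, so that its exterior power acts through iterated Clifford products.
\<close>

definition U_fibre ::
  "nat \<Rightarrow> ('e::real_normed_vector gtangent \<Rightarrow>\<^sub>L 'e gtangent) \<Rightarrow> int \<Rightarrow> 'e mform set" where
  "U_fibre n T k =
     (if k \<le> int n
      then cspan {foldr clifford ws \<rho> | ws \<rho>.
             length ws = nat (int n - k) \<and> set ws \<subseteq> cconj ` i_eigenspace T \<and> \<rho> \<in> canonical_line T}
      else {0})"

text \<open>
  The \<open>(p,q)\<close>-forms are spanned by wedge products of \<open>p\<close> complex covectors of type \<open>(1,0)\<close> and
  \<open>q\<close> of type \<open>(0,1)\<close>.
\<close>

definition pq_fibre :: "('e::real_normed_vector \<Rightarrow>\<^sub>L 'e) \<Rightarrow> int \<Rightarrow> int \<Rightarrow> 'e mform set" where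
  "pq_fibre J p q =
     (if 0 \<le> p \<and> 0 \<le> q
      then cspan {foldr covector_wedge (map blinfun_apply (\<xi>s @ \<eta>s)) unit_form
             | (\<xi>s :: ('e \<Rightarrow>\<^sub>L complex) list) \<eta>s.
               length \<xi>s = nat p \<and> (\<forall>\<xi>\<in>set \<xi>s. \<forall>v. \<xi> (J v) = \<i> * \<xi> v) \<and>
               length \<eta>s = nat q \<and> (\<forall>\<eta>\<in>set \<eta>s. \<forall>v. \<eta> (J v) = - \<i> * \<eta> v)}
      else {0})"

section \<open>Differential forms\<close>

type_synonym ('a, 'e) form_field = "('a, 'e) chart \<Rightarrow> 'e \<Rightarrow> 'e mform"

text \<open>
  Smooth mixed-degree complex differential forms. Local representatives vanish outside of
  their chart by convention, so that equal forms are equal functions.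
\<close>

definition forms :: "('a, 'e::real_normed_vector) chart set \<Rightarrow> ('a, 'e) form_field set" where
  "forms A = {\<omega>.
     (\<forall>c x. c \<notin> A \<or> x \<notin> chart_image c \<longrightarrow> \<omega> c x = 0) \<and>
     (\<forall>c\<in>A. \<forall>x\<in>chart_image c. alternating (\<omega> c x)) \<and>
     (\<forall>c\<in>A. \<forall>vs. smooth_on (chart_image c) (\<lambda>x. \<omega> c x vs)) \<and>
     (\<forall>c\<in>A. \<forall>c'\<in>A. \<forall>x\<in>overlap c c'. \<forall>vs.
        \<omega> c x vs = \<omega> c' (transition c c' x) (map (dtransition c c' x) vs))}"

definition forms_of_degree ::
  "('a, 'e::real_normed_vector) chart set \<Rightarrow> int \<Rightarrow> ('a, 'e) form_field set" where
  "forms_of_degree A k = {\<omega>\<in>forms A. \<forall>c x vs. int (length vs) \<noteq> k \<longrightarrow> \<omega> c x vs = 0}"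

definition ext_deriv ::
  "('a, 'e::real_normed_vector) chart set \<Rightarrow> ('a, 'e) form_field \<Rightarrow> ('a, 'e) form_field" where
  "ext_deriv A \<omega> c x vs =
     (if c \<in> A \<and> x \<in> chart_image c
      then \<Sum>i<length vs. (-1) ^ i * frechet_derivative (\<lambda>y. \<omega> c y (omit_nth i vs)) (at x) (vs ! i)
      else 0)"

definition U_forms ::
  "nat \<Rightarrow> ('a, 'e::real_normed_vector) chart set \<Rightarrow>
   (('a, 'e) chart \<Rightarrow> 'e \<Rightarrow> 'e gtangent \<Rightarrow>\<^sub>L 'e gtangent) \<Rightarrow> int \<Rightarrow> ('a, 'e) form_field set" where
  "U_forms n A JJ k = {\<omega>\<in>forms A. \<forall>c\<in>A. \<forall>x\<in>chart_image c. \<omega> c x \<in> U_fibre n (JJ c x) k}"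

definition pq_forms ::
  "('a, 'e::real_normed_vector) chart set \<Rightarrow> (('a, 'e) chart \<Rightarrow> 'e \<Rightarrow> 'e \<Rightarrow>\<^sub>L 'e) \<Rightarrow>
   int \<Rightarrow> int \<Rightarrow> ('a, 'e) form_field set" where
  "pq_forms A J p q = {\<omega>\<in>forms A. \<forall>c\<in>A. \<forall>x\<in>chart_image c. \<omega> c x \<in> pq_fibre (J c x) p q}"

section \<open>Cohomology\<close>

text \<open>
  The complex vector space \<open>V / W\<close> of cosets of \<open>W\<close>; the multiplicative part of the underlying
  record is irrelevant. Adding \<open>W\<close> in the scalar multiplication only matters for \<open>z = 0\<close>.
\<close>

definition quotient_space ::
  "('a, 'e) form_field set \<Rightarrow> ('a, 'e) form_field set \<Rightarrow> (complex, ('a, 'e) form_field set) module"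
where
  "quotient_space V W =
     \<lparr>carrier = {\<alpha> +o W | \<alpha>. \<alpha> \<in> V}, mult = undefined, one = undefined,
      zero = W, add = (+), smult = (\<lambda>z S. {\<lambda>c x vs. z * \<alpha> c x vs | \<alpha>. \<alpha> \<in> S} + W)\<rparr>"

text \<open>
  \<open>M\<close> is the internal direct sum of the subspaces \<open>S i\<close>: every element is in a unique way a
  sum of finitely many nonzero elements, one from each of finitely many of the subspaces.
\<close>

definition internal_direct_sum :: "('r, 'm) module \<Rightarrow> 'i set \<Rightarrow> ('i \<Rightarrow> 'm set) \<Rightarrow> bool" where
  "internal_direct_sum M I S \<longleftrightarrow>
     (\<forall>i\<in>I. S i \<subseteq> carrier M) \<and>
     (\<forall>m\<in>carrier M. \<exists>!s. s \<in> Pi\<^sub>E I S \<and> finite {i\<in>I. s i \<noteq> \<zero>\<^bsub>M\<^esub>} \<and>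
        m = finsum M s {i\<in>I. s i \<noteq> \<zero>\<^bsub>M\<^esub>})"

definition GH_dR ::
  "('a, 'e::real_normed_vector) chart set \<Rightarrow> (complex, ('a, 'e) form_field set) module" where
  "GH_dR A = quotient_space {\<omega>\<in>forms A. ext_deriv A \<omega> = 0} (ext_deriv A ` forms A)"

definition GH_J ::
  "nat \<Rightarrow> ('a, 'e::real_normed_vector) chart set \<Rightarrow>
   (('a, 'e) chart \<Rightarrow> 'e \<Rightarrow> 'e gtangent \<Rightarrow>\<^sub>L 'e gtangent) \<Rightarrow> int \<Rightarrow> ('a, 'e) form_field set set" where
  "GH_J n A JJ k = {\<omega> +o (ext_deriv A ` forms A) | \<omega>. \<omega> \<in> U_forms n A JJ k \<and> ext_deriv A \<omega> = 0}"

definition gacs_pure_and_full ::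
  "nat \<Rightarrow> ('a, 'e::real_normed_vector) chart set \<Rightarrow>
   (('a, 'e) chart \<Rightarrow> 'e \<Rightarrow> 'e gtangent \<Rightarrow>\<^sub>L 'e gtangent) \<Rightarrow> bool" where
  "gacs_pure_and_full n A JJ \<longleftrightarrow> internal_direct_sum (GH_dR A) UNIV (GH_J n A JJ)"

definition H_dR ::
  "('a, 'e::real_normed_vector) chart set \<Rightarrow> int \<Rightarrow> (complex, ('a, 'e) form_field set) module" where
  "H_dR A k =
     quotient_space {\<omega>\<in>forms_of_degree A k. ext_deriv A \<omega> = 0}
       (ext_deriv A ` forms_of_degree A (k - 1))"

definition H_J ::
  "('a, 'e::real_normed_vector) chart set \<Rightarrow> (('a, 'e) chart \<Rightarrow> 'e \<Rightarrow> 'e \<Rightarrow>\<^sub>L 'e) \<Rightarrow>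
   int \<Rightarrow> int \<Rightarrow> ('a, 'e) form_field set set" where
  "H_J A J p q =
     {\<omega> +o (ext_deriv A ` forms_of_degree A (p + q - 1)) | \<omega>.
        \<omega> \<in> pq_forms A J p q \<and> ext_deriv A \<omega> = 0}"

definition complex_pure_and_full_at_stage ::
  "('a, 'e::real_normed_vector) chart set \<Rightarrow> (('a, 'e) chart \<Rightarrow> 'e \<Rightarrow> 'e \<Rightarrow>\<^sub>L 'e) \<Rightarrow> int \<Rightarrow> bool" where
  "complex_pure_and_full_at_stage A J k \<longleftrightarrow>
     internal_direct_sum (H_dR A k) {(p, q). p + q = k} (\<lambda>(p, q). H_J A J p q)"

end

theory Submission
  imports Defs
begin

text \<open>
  On a fibre of the tangent bundle, with the complex structure \<open>J\<close>, the eigenbundle \<open>L\<close> of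
  \<open>\<J>\<^sub>J\<close> consists of vectors of type \<open>(0,1)\<close> and covectors of type \<open>(1,0)\<close>, so its pure
  spinors are the forms of type \<open>(n,0)\<close>. The conjugate of \<open>L\<close> acts on them by contractions with
  vectors of type \<open>(1,0)\<close> and by wedge products with covectors of type \<open>(0,1)\<close>; each of these
  operations lowers \<open>p - q\<close> by one. Hence \<open>U\<^sup>k\<close> is the sum of the spaces of \<open>(p,q)\<close>-forms with
  \<open>p - q = k\<close>, which is lemma \<open>U_fibre_gacs_fibre\<close>.

  The two numbers \<open>p + q\<close> and \<open>p - q\<close> determine \<open>(p,q)\<close>. So the component of degree \<open>j\<close> of a
  section of \<open>U\<^sup>k\<close> is a form of a single type \<open>(p,q)\<close>, and it is smooth as a component of fixed
  degree of a smooth form; no projection that depends on \<open>J\<close> occurs. The exterior derivative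
  raises the degree by one. Therefore a mixed-degree form is closed, or exact, if and only if all
  its components are, and a decomposition of a class along the \<open>U\<^sup>k\<close> is the same as a family of
  decompositions, one in each degree, along the types \<open>(p,q)\<close>. Lemma \<open>bigraded_splits_iff\<close>
  carries out this bookkeeping in an arbitrary abelian group. Only degrees \<open>0, \<dots>, 2n\<close> occur, so
  that all sums are finite.

  The linear algebra on a fibre avoids complex bases. With a real orthonormal basis \<open>B\<close>, the
  operator \<open>half_euler \<i>\<close> multiplies forms of type \<open>(p,q)\<close> by \<open>4p\<close>, and \<open>half_euler (-\<i>)\<close> by
  \<open>4q\<close>. Together with the anticommutation of wedge products and contractions, these two
  eigenvalue equations show that there are no forms with \<open>p > n\<close>, that pure spinors have degree
  \<open>n\<close>, and that every form of type \<open>(p,q)\<close> is reached from type \<open>(n,0)\<close> by the action of the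
  conjugate of \<open>L\<close>.
\<close>

section \<open>Contractions and wedge products of mixed-degree forms\<close>

definition scale_form :: "complex \<Rightarrow> 'e mform \<Rightarrow> 'e mform" where
  "scale_form z \<phi> = (\<lambda>vs. z * \<phi> vs)"

interpretation mform: vector_space scale_form
  by unfold_locales (auto simp: scale_form_def fun_eq_iff algebra_simps)

lemma cspan_eq_span: "cspan = mform.span"
  unfolding cspan_def scale_form_def[abs_def] ..

abbreviation form_linear :: "('e mform \<Rightarrow> 'e mform) \<Rightarrow> bool" where
  "form_linear \<equiv> module_hom scale_form scale_form"

lemma form_linearI:
  assumes "\<And>\<phi> \<psi>. f (\<phi> + \<psi>) = f \<phi> + f \<psi>" "\<And>z \<phi>. f (scale_form z \<phi>) = scale_form z (f \<phi>)"
  shows "form_linear f"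
  using assms mform.module_axioms by (auto simp: module_hom_iff)

lemma cspan_subspaceI:
  assumes "G \<subseteq> S" "mform.subspace S"
  shows "cspan G \<subseteq> S"
  using assms by (simp add: cspan_eq_span mform.span_minimal)

lemma subspace_cspan: "mform.subspace (cspan G)"
  by (simp add: cspan_eq_span)

lemma form_linear_cspan:
  assumes "form_linear f" "\<And>\<phi>. \<phi> \<in> G \<Longrightarrow> f \<phi> \<in> S" "mform.subspace S" "\<phi> \<in> cspan G"
  shows "f \<phi> \<in> S"
proof -
  have "cspan G \<subseteq> f -` S"
    using assms(2) module_hom.subspace_vimage[OF assms(1,3)] by (intro cspan_subspaceI) auto
  then show ?thesis using assms(4) by auto
qed

lemma sum_form_apply: "(\<Sum>i\<in>I. f i) vs = (\<Sum>i\<in>I. (f i vs :: 'b::comm_monoid_add))"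
  by (induction I rule: infinite_finite_induct) auto

lemma covector_wedge_Nil [simp]: "covector_wedge \<xi> \<phi> [] = 0"
  by (simp add: covector_wedge_def)

text \<open>
  Cartan's rule for a contraction of a wedge product, read as a recursion over the arguments. It
  makes signs tractable: most identities for wedge products follow from it by induction over the
  list of arguments, with the form generalized.
\<close>
lemma covector_wedge_Cons:
  "covector_wedge \<xi> \<phi> (v # vs) = \<xi> v * \<phi> vs - covector_wedge \<xi> (interior_product v \<phi>) vs"
  unfolding covector_wedge_def
  by (simp add: sum.lessThan_Suc_shift omit_nth_def interior_product_def sum_negf del: sum.lessThan_Suc)

lemma interior_covector_wedge:
  "interior_product v (covector_wedge \<xi> \<phi>) =
     scale_form (\<xi> v) \<phi> - covector_wedge \<xi> (interior_product v \<phi>)"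
  by (rule ext)
     (simp add: scale_form_def interior_product_def[of v "covector_wedge _ _"] covector_wedge_Cons)

lemma form_linear_interior: "form_linear (interior_product v)"
  by (rule form_linearI) (auto simp: interior_product_def scale_form_def fun_eq_iff)

lemma form_linear_wedge: "form_linear (covector_wedge \<xi>)"
  by (rule form_linearI)
     (auto simp: covector_wedge_def scale_form_def fun_eq_iff algebra_simps sum.distrib sum_distrib_left)

lemma covector_wedge_add_left:
  "covector_wedge (\<lambda>v. \<xi> v + \<eta> v) \<phi> = covector_wedge \<xi> \<phi> + covector_wedge \<eta> \<phi>"
  by (auto simp: covector_wedge_def fun_eq_iff algebra_simps sum.distrib)

lemma covector_wedge_scale_left:
  "covector_wedge (\<lambda>v. z * \<xi> v) \<phi> = scale_form z (covector_wedge \<xi> \<phi>)"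
  by (auto simp: covector_wedge_def scale_form_def fun_eq_iff algebra_simps sum_distrib_left)

lemma covector_wedge_sum_left:
  "covector_wedge (\<lambda>v. \<Sum>i\<in>I. \<xi> i v) \<phi> = (\<Sum>i\<in>I. covector_wedge (\<xi> i) \<phi>)"
  by (induction I rule: infinite_finite_induct)
     (simp_all add: covector_wedge_add_left, simp_all add: covector_wedge_def fun_eq_iff)

lemmas interior_simps = module_hom.add[OF form_linear_interior] module_hom.scale[OF form_linear_interior]
  module_hom.diff[OF form_linear_interior] module_hom.neg[OF form_linear_interior]
  module_hom.sum[OF form_linear_interior] module_hom.zero[OF form_linear_interior]
lemmas wedge_simps = module_hom.add[OF form_linear_wedge] module_hom.scale[OF form_linear_wedge]
  module_hom.diff[OF form_linear_wedge] module_hom.neg[OF form_linear_wedge]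
  module_hom.sum[OF form_linear_wedge] module_hom.zero[OF form_linear_wedge]

lemma covector_wedge_anticommute:
  "covector_wedge \<xi> (covector_wedge \<eta> \<phi>) = - covector_wedge \<eta> (covector_wedge \<xi> \<phi>)"
proof
  fix vs show "covector_wedge \<xi> (covector_wedge \<eta> \<phi>) vs = (- covector_wedge \<eta> (covector_wedge \<xi> \<phi>)) vs"
  proof (induction vs arbitrary: \<phi>)
    case (Cons v vs)
    show ?case
      using Cons.IH[of "interior_product v \<phi>"]
      by (simp add: covector_wedge_Cons interior_covector_wedge wedge_simps scale_form_def[of _ "covector_wedge _ _"])
  qed simp
qed

section \<open>Alternating forms\<close>

definition multilinear_form :: "'e::real_vector mform \<Rightarrow> bool" where
  "multilinear_form \<phi> \<longleftrightarrow> (\<forall>us ws. linear (\<lambda>v. \<phi> (us @ v # ws)))"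

lemma multilinear_adjacent_swap:
  assumes m: "multilinear_form \<phi>" and z: "\<And>us v ws. \<phi> (us @ v # v # ws) = 0"
  shows "\<phi> (us @ v # w # ws) = - \<phi> (us @ w # v # ws)"
proof -
  have l1: "linear (\<lambda>v. \<phi> (us @ v # (x # ws)))" for x using m unfolding multilinear_form_def by blast
  have "linear (\<lambda>v. \<phi> ((us @ [x]) @ v # ws))" for x using m unfolding multilinear_form_def by blast
  then have l2: "linear (\<lambda>v. \<phi> (us @ x # v # ws))" for x by simp
  have "0 = \<phi> (us @ (v + w) # (v + w) # ws)" using z by simp
  also have "\<dots> = \<phi> (us @ v # v # ws) + \<phi> (us @ v # w # ws) + \<phi> (us @ w # v # ws) + \<phi> (us @ w # w # ws)"
    by (simp add: linear_add[OF l1] linear_add[OF l2])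
  finally show ?thesis by (simp add: z eq_neg_iff_add_eq_0)
qed

text \<open>
  Vanishing at equal neighbours is compatible with the recursion for wedge products, in contrast
  to vanishing at all lists with a repetition. Equal entries that are further apart are brought
  together by swaps of neighbours, each of which changes the sign.
\<close>
lemma alternating_iff_adjacent:
  "alternating \<phi> \<longleftrightarrow> multilinear_form \<phi> \<and> (\<forall>us v ws. \<phi> (us @ v # v # ws) = 0)"
proof
  assume "alternating \<phi>" then show "multilinear_form \<phi> \<and> (\<forall>us v ws. \<phi> (us @ v # v # ws) = 0)"
    by (auto simp: alternating_def multilinear_form_def)
next
  assume a: "multilinear_form \<phi> \<and> (\<forall>us v ws. \<phi> (us @ v # v # ws) = 0)"
  have *: "\<phi> (us @ v # xs @ v # ws) = 0" for us v xs ws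
  proof (induction xs arbitrary: us)
    case Nil then show ?case using a by simp
  next
    case (Cons x xs)
    have "\<phi> (us @ v # x # (xs @ v # ws)) = - \<phi> (us @ x # v # (xs @ v # ws))"
      using a by (intro multilinear_adjacent_swap) auto
    also have "\<phi> (us @ x # v # (xs @ v # ws)) = 0" using Cons.IH[of "us @ [x]"] by simp
    finally show ?case by simp
  qed
  have "\<phi> vs = 0" if "\<not> distinct vs" for vs
    using not_distinct_decomp[OF that] * by force
  then show "alternating \<phi>" using a by (auto simp: alternating_def multilinear_form_def)
qed

lemma linear_mult_complex: "linear f \<Longrightarrow> linear (\<lambda>v. (z :: complex) * f v)"
  by (simp add: linear_iff algebra_simps)

lemma alternating_subspace: "mform.subspace {\<phi>. alternating \<phi>}"
proof (unfold mform.subspace_def, safe)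
  show "alternating 0" by (simp add: alternating_def module_hom_zero)
next
  fix \<phi> \<psi> :: "'a mform" assume "alternating \<phi>" "alternating \<psi>"
  then show "alternating (\<phi> + \<psi>)"
    unfolding alternating_def plus_fun_apply by (intro conjI allI linear_compose_add impI) simp_all
next
  fix z and \<phi> :: "'a mform" assume "alternating \<phi>"
  then show "alternating (scale_form z \<phi>)"
    unfolding alternating_def scale_form_def by (metis linear_mult_complex mult_zero_right)
qed

lemma multilinear_interior:
  assumes "multilinear_form \<phi>" shows "multilinear_form (interior_product v \<phi>)"
  unfolding multilinear_form_def
proof (intro allI)
  fix us ws
  have "linear (\<lambda>x. \<phi> ((v # us) @ x # ws))" using assms unfolding multilinear_form_def by blast
  then show "linear (\<lambda>x. interior_product v \<phi> (us @ x # ws))" by (simp add: interior_product_def)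
qed

lemma alternating_interior: "alternating \<phi> \<Longrightarrow> alternating (interior_product v \<phi>)"
  unfolding alternating_iff_adjacent
  by (metis multilinear_interior interior_product_def append_Cons)

lemma interior_add_vector:
  assumes "multilinear_form \<phi>"
  shows "interior_product (v + w) \<phi> = interior_product v \<phi> + interior_product w \<phi>"
proof
  fix vs
  have "linear (\<lambda>v. \<phi> ([] @ v # vs))" using assms unfolding multilinear_form_def by blast
  then show "interior_product (v + w) \<phi> vs = (interior_product v \<phi> + interior_product w \<phi>) vs"
    by (simp add: interior_product_def linear_iff)
qed

lemma interior_scale_vector:
  assumes "multilinear_form \<phi>"
  shows "interior_product (r *\<^sub>R v) \<phi> = scale_form (of_real r) (interior_product v \<phi>)"
proof
  fix vs
  have "linear (\<lambda>v. \<phi> ([] @ v # vs))" using assms unfolding multilinear_form_def by blast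
  then show "interior_product (r *\<^sub>R v) \<phi> vs = scale_form (of_real r) (interior_product v \<phi>) vs"
    by (auto simp add: interior_product_def scale_form_def scaleR_conv_of_real dest: linear_scale)
qed

lemma interior_sum_vector:
  assumes "multilinear_form \<phi>"
  shows "interior_product (\<Sum>i\<in>I. r i *\<^sub>R v i) \<phi> = (\<Sum>i\<in>I. scale_form (of_real (r i)) (interior_product (v i) \<phi>))"
proof -
  have 0: "interior_product 0 \<phi> = 0" using interior_scale_vector[OF assms, of 0 0] by simp
  show ?thesis
  by (induction I rule: infinite_finite_induct)
     (simp_all add: 0 interior_add_vector[OF assms] interior_scale_vector[OF assms])
qed

lemma interior_anticommute:
  assumes "alternating \<phi>"
  shows "interior_product v (interior_product w \<phi>) = - interior_product w (interior_product v \<phi>)"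
proof
  fix vs
  have "\<phi> ([] @ w # v # vs) = - \<phi> ([] @ v # w # vs)"
    using assms unfolding alternating_iff_adjacent by (intro multilinear_adjacent_swap) auto
  then show "interior_product v (interior_product w \<phi>) vs = (- interior_product w (interior_product v \<phi>)) vs"
    by (simp add: interior_product_def)
qed

lemma multilinear_wedge:
  assumes \<xi>: "linear \<xi>" and m: "multilinear_form \<phi>"
  shows "multilinear_form (covector_wedge \<xi> \<phi>)"
proof -
  have "linear (\<lambda>v. covector_wedge \<xi> \<phi> (us @ v # ws))" for us ws
    using m
  proof (induction us arbitrary: \<phi>)
    case Nil
    show ?case
      by (rule linearI)
         (simp_all add: covector_wedge_Cons linear_add[OF \<xi>] linear_scale[OF \<xi>] wedge_simps
           interior_add_vector[OF Nil] interior_scale_vector[OF Nil] algebra_simps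
           scale_form_def[of _ "covector_wedge _ _"] scaleR_conv_of_real)
  next
    case (Cons u us)
    have "linear (\<lambda>v. \<phi> (us @ v # ws))" using Cons.prems unfolding multilinear_form_def by blast
    then have "linear (\<lambda>v. \<xi> u * \<phi> (us @ v # ws))"
      by (rule linear_mult_complex)
    from linear_compose_sub[OF this Cons.IH[OF multilinear_interior[OF Cons.prems]]]
    show ?case by (simp add: covector_wedge_Cons)
  qed
  then show ?thesis by (simp add: multilinear_form_def)
qed

lemma alternating_wedge:
  assumes \<xi>: "linear \<xi>" and a: "alternating \<phi>"
  shows "alternating (covector_wedge \<xi> \<phi>)"
  unfolding alternating_iff_adjacent
proof (intro conjI allI)
  show "multilinear_form (covector_wedge \<xi> \<phi>)"
    using a \<xi> multilinear_wedge alternating_iff_adjacent by blast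
  show "covector_wedge \<xi> \<phi> (us @ v # v # ws) = 0" for us v ws
    using a
  proof (induction us arbitrary: \<phi>)
    case Nil
    have "interior_product v (interior_product v \<phi>) = 0"
      using Nil unfolding alternating_iff_adjacent interior_product_def fun_eq_iff
      by (metis append_Nil zero_fun_apply)
    then show ?case by (simp add: covector_wedge_Cons wedge_simps interior_product_def)
  next
    case (Cons u us)
    have "\<phi> (us @ v # v # ws) = 0" using Cons.prems unfolding alternating_iff_adjacent by blast
    then show ?case using Cons.IH[OF alternating_interior[OF Cons.prems]]
      by (simp add: covector_wedge_Cons)
  qed
qed

lemma alternating_unit_form: "alternating unit_form"
  by (auto simp: alternating_def unit_form_def linear_iff)

section \<open>Vectors and covectors of a type\<close>

text \<open>
  Contraction with \<open>v - zJv\<close>, and the covector \<open>\<xi> - z(\<xi> \<circ> J)\<close>, for \<open>z = \<i>\<close> or \<open>z = -\<i>\<close>. These are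
  twice the components of \<open>v\<close> and of \<open>\<xi>\<close> of type \<open>(1,0)\<close> if \<open>z = \<i>\<close>, and of type \<open>(0,1)\<close> if
  \<open>z = -\<i>\<close>. The parameter \<open>z\<close> lets conjugate statements share one proof.
\<close>
definition half_interior ::
  "complex \<Rightarrow> ('e::real_normed_vector \<Rightarrow>\<^sub>L 'e) \<Rightarrow> 'e \<Rightarrow> 'e mform \<Rightarrow> 'e mform" where
  "half_interior z J v \<phi> = interior_product v \<phi> - scale_form z (interior_product (J v) \<phi>)"

definition half_covector ::
  "complex \<Rightarrow> ('e::real_normed_vector \<Rightarrow>\<^sub>L 'e) \<Rightarrow> ('e \<Rightarrow> complex) \<Rightarrow> 'e \<Rightarrow> complex" where
  "half_covector z J \<xi> v = \<xi> v - z * \<xi> (J v)"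

definition eigen_covector ::
  "complex \<Rightarrow> ('e::real_normed_vector \<Rightarrow>\<^sub>L 'e) \<Rightarrow> ('e \<Rightarrow> complex) \<Rightarrow> bool" where
  "eigen_covector z J \<xi> \<longleftrightarrow> bounded_linear \<xi> \<and> (\<forall>v. \<xi> (J v) = z * \<xi> v)"

lemma form_linear_half_interior: "form_linear (half_interior z J v)"
  by (rule form_linearI)
     (simp_all add: half_interior_def interior_simps mform.scale_right_distrib
       mform.scale_right_diff_distrib mult.commute)

lemmas half_interior_simps =
  module_hom.add[OF form_linear_half_interior] module_hom.scale[OF form_linear_half_interior]
  module_hom.diff[OF form_linear_half_interior] module_hom.neg[OF form_linear_half_interior]
  module_hom.sum[OF form_linear_half_interior] module_hom.zero[OF form_linear_half_interior]

lemma half_interior_covector_wedge: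
  "half_interior z J v (covector_wedge \<xi> \<phi>) =
     scale_form (half_covector z J \<xi> v) \<phi> - covector_wedge \<xi> (half_interior z J v \<phi>)"
  by (simp add: half_interior_def half_covector_def interior_covector_wedge wedge_simps
      mform.scale_left_diff_distrib mform.scale_right_diff_distrib)

lemma half_covector_eigen:
  assumes "eigen_covector z J \<xi>" "z\<^sup>2 = -1" shows "half_covector z J \<xi> v = 2 * \<xi> v"
proof -
  have "half_covector z J \<xi> v = \<xi> v - z\<^sup>2 * \<xi> v"
    using assms(1) by (simp add: half_covector_def eigen_covector_def power2_eq_square)
  then show ?thesis using assms(2) by simp
qed

lemma half_covector_opposite_eigen:
  assumes "eigen_covector (- z) J \<xi>" "z\<^sup>2 = -1" shows "half_covector z J \<xi> v = 0"
proof -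
  have "half_covector z J \<xi> v = \<xi> v + z\<^sup>2 * \<xi> v"
    using assms(1) by (simp add: half_covector_def eigen_covector_def power2_eq_square)
  then show ?thesis using assms(2) by simp
qed

lemma half_interior_wedge_opposite:
  assumes "eigen_covector (- z) J \<xi>" "z\<^sup>2 = -1"
  shows "half_interior z J v (covector_wedge \<xi> \<phi>) = - covector_wedge \<xi> (half_interior z J v \<phi>)"
  by (simp only: half_interior_covector_wedge half_covector_opposite_eigen[OF assms]
      mform.scale_zero_left diff_0)

lemma eigen_covector_half_covector:
  fixes J :: "'e::real_normed_vector \<Rightarrow>\<^sub>L 'e"
  assumes "bounded_linear \<xi>" "z\<^sup>2 = -1" "\<And>v. J (J v) = - v"
  shows "eigen_covector z J (half_covector z J \<xi>)"
  unfolding eigen_covector_def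
proof (intro conjI allI)
  show "bounded_linear (half_covector z J \<xi>)"
    unfolding half_covector_def[abs_def]
    by (intro bounded_linear_sub assms(1) bounded_linear_const_mult
        bounded_linear_compose[OF assms(1) blinfun.bounded_linear_right])
  have "\<xi> (- v) = - \<xi> v" for v
    using assms(1) by (simp add: bounded_linear.linear linear_neg)
  then have "half_covector z J \<xi> (J v) = \<xi> (J v) + z * \<xi> v" for v
    by (simp add: half_covector_def assms(3))
  moreover have "z * (z * c) = - c" for c :: complex
    using assms(2) by (simp add: power2_eq_square flip: mult.assoc)
  ultimately show "half_covector z J \<xi> (J v) = z * half_covector z J \<xi> v" for v
    by (simp add: half_covector_def right_diff_distrib)
qed

lemma alternating_half_interior: "alternating \<phi> \<Longrightarrow> alternating (half_interior z J v \<phi>)"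
  unfolding half_interior_def
  using alternating_subspace mform.subspace_diff mform.subspace_scale alternating_interior
  by (metis mem_Collect_eq)

section \<open>Forms of type (p,q) on a fibre\<close>

text \<open>
  The monomials that span the \<open>(p,q)\<close>-forms, with natural exponents and with functions instead
  of bundled bounded linear maps as factors, so that a half covector can be a factor.
\<close>
definition pq_monomials :: "('e::real_normed_vector \<Rightarrow>\<^sub>L 'e) \<Rightarrow> nat \<Rightarrow> nat \<Rightarrow> 'e mform set" where
  "pq_monomials J p q = {foldr covector_wedge (\<xi>s @ \<eta>s) unit_form | \<xi>s \<eta>s.
     length \<xi>s = p \<and> (\<forall>\<xi>\<in>set \<xi>s. eigen_covector \<i> J \<xi>) \<and>
     length \<eta>s = q \<and> (\<forall>\<eta>\<in>set \<eta>s. eigen_covector (- \<i>) J \<eta>)}"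

lemma eigen_covector_blinfun_apply:
  "eigen_covector z J (blinfun_apply \<xi>) \<longleftrightarrow> (\<forall>v. \<xi> (J v) = z * \<xi> v)"
  by (simp add: eigen_covector_def blinfun.bounded_linear_right)

lemma map_blinfun_apply_Blinfun:
  "\<forall>\<xi>\<in>set \<xi>s. eigen_covector z J \<xi> \<Longrightarrow> map blinfun_apply (map Blinfun \<xi>s) = \<xi>s"
  by (auto simp: eigen_covector_def bounded_linear_Blinfun_apply intro!: map_idI)

lemma pq_fibre_eq_cspan: "pq_fibre J (int p) (int q) = cspan (pq_monomials J p q)"
proof -
  have "pq_monomials J p q = {foldr covector_wedge (map blinfun_apply (\<xi>s @ \<eta>s)) unit_form
             | (\<xi>s :: ('a \<Rightarrow>\<^sub>L complex) list) \<eta>s.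
               length \<xi>s = p \<and> (\<forall>\<xi>\<in>set \<xi>s. \<forall>v. \<xi> (J v) = \<i> * \<xi> v) \<and>
               length \<eta>s = q \<and> (\<forall>\<eta>\<in>set \<eta>s. \<forall>v. \<eta> (J v) = - \<i> * \<eta> v)}" (is "_ = ?R")
  proof (intro equalityI subsetI)
    fix \<phi> assume "\<phi> \<in> pq_monomials J p q"
    then obtain \<xi>s \<eta>s where *: "\<phi> = foldr covector_wedge (\<xi>s @ \<eta>s) unit_form" "length \<xi>s = p"
      "\<forall>\<xi>\<in>set \<xi>s. eigen_covector \<i> J \<xi>" "length \<eta>s = q" "\<forall>\<eta>\<in>set \<eta>s. eigen_covector (- \<i>) J \<eta>"
      unfolding pq_monomials_def by blast
    note m = map_blinfun_apply_Blinfun[OF *(3)] map_blinfun_apply_Blinfun[OF *(5)]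
    have "\<phi> = foldr covector_wedge (map blinfun_apply (map Blinfun \<xi>s @ map Blinfun \<eta>s)) unit_form"
      unfolding map_append m *(1) ..
    moreover have "length (map Blinfun \<xi>s) = p" "length (map Blinfun \<eta>s) = q" using * by auto
    moreover have "\<forall>\<xi>\<in>set (map Blinfun \<xi>s). eigen_covector \<i> J (blinfun_apply \<xi>)"
      using *(3) by (metis (no_types, lifting) m(1) image_eqI list.set_map)
    moreover have "\<forall>\<xi>\<in>set (map Blinfun \<eta>s). eigen_covector (-\<i>) J (blinfun_apply \<xi>)"
      using *(5) by (metis (no_types, lifting) m(2) image_eqI list.set_map)
    ultimately show "\<phi> \<in> ?R" unfolding eigen_covector_blinfun_apply by blast
  next
    fix \<phi> assume "\<phi> \<in> ?R"
    then obtain \<xi>s \<eta>s :: "('a \<Rightarrow>\<^sub>L complex) list" where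
      *: "\<phi> = foldr covector_wedge (map blinfun_apply \<xi>s @ map blinfun_apply \<eta>s) unit_form"
      "length \<xi>s = p" "(\<forall>\<xi>\<in>set \<xi>s. \<forall>v. \<xi> (J v) = \<i> * \<xi> v)"
      "length \<eta>s = q" "(\<forall>\<eta>\<in>set \<eta>s. \<forall>v. \<eta> (J v) = - \<i> * \<eta> v)"
      unfolding map_append by blast
    show "\<phi> \<in> pq_monomials J p q"
      unfolding pq_monomials_def *(1) using *(2-)
      by (intro CollectI exI[of _ "map blinfun_apply \<xi>s"] exI[of _ "map blinfun_apply \<eta>s"])
         (auto simp: eigen_covector_blinfun_apply)
  qed
  then show ?thesis by (simp add: pq_fibre_def)
qed

lemma pq_fibre_negative: "p < 0 \<or> q < 0 \<Longrightarrow> pq_fibre J p q = {0}"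
  by (auto simp: pq_fibre_def)

lemma subspace_pq_fibre: "mform.subspace (pq_fibre J p q)"
  by (auto simp: pq_fibre_def subspace_cspan mform.subspace_single_0)

lemmas pq_fibre_diff = mform.subspace_diff[OF subspace_pq_fibre]
lemmas pq_fibre_scale = mform.subspace_scale[OF subspace_pq_fibre]
lemmas pq_fibre_0 = mform.subspace_0[OF subspace_pq_fibre]
lemmas pq_fibre_neg = mform.subspace_neg[OF subspace_pq_fibre]
lemmas pq_fibre_sum = mform.subspace_sum[OF subspace_pq_fibre]

lemma pq_monomials_subset: "pq_monomials J p q \<subseteq> pq_fibre J (int p) (int q)"
  by (simp add: pq_fibre_eq_cspan cspan_eq_span mform.span_superset)

lemma unit_form_pq_fibre: "unit_form \<in> pq_fibre J 0 0"
  using pq_monomials_subset[of J 0 0] by (auto simp: pq_monomials_def)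

lemma pq_fibre_cases:
  obtains "p < 0 \<or> q < 0" "pq_fibre J p q = {0}"
  | p' q' where "p = int p'" "q = int q'" "pq_fibre J p q = cspan (pq_monomials J p' q')"
  by (metis pq_fibre_negative pq_fibre_eq_cspan nonneg_int_cases not_less)

lemma pq_fibre_wedge_10:
  assumes \<xi>: "eigen_covector \<i> J \<xi>" and \<phi>: "\<phi> \<in> pq_fibre J p q"
  shows "covector_wedge \<xi> \<phi> \<in> pq_fibre J (p + 1) q"
proof (cases rule: pq_fibre_cases[where p = p and q = q and J = J])
  case 1
  then show ?thesis using \<phi> by (simp add: wedge_simps pq_fibre_0)
next
  case (2 p' q')
  show ?thesis
  proof (rule form_linear_cspan[OF form_linear_wedge _ subspace_pq_fibre])
    show "\<phi> \<in> cspan (pq_monomials J p' q')" using \<phi> 2 by simp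
    fix \<psi> assume "\<psi> \<in> pq_monomials J p' q'"
    then obtain \<xi>s \<eta>s where *: "\<psi> = foldr covector_wedge (\<xi>s @ \<eta>s) unit_form" "length \<xi>s = p'"
      "\<forall>\<xi>\<in>set \<xi>s. eigen_covector \<i> J \<xi>" "length \<eta>s = q'" "\<forall>\<eta>\<in>set \<eta>s. eigen_covector (- \<i>) J \<eta>"
      unfolding pq_monomials_def by blast
    have "covector_wedge \<xi> \<psi> \<in> pq_monomials J (Suc p') q'"
      unfolding pq_monomials_def using * \<xi>
      by (intro CollectI exI[of _ "\<xi> # \<xi>s"] exI[of _ \<eta>s]) auto
    then show "covector_wedge \<xi> \<psi> \<in> pq_fibre J (p + 1) q"
      using pq_monomials_subset 2 by (metis of_nat_Suc add.commute subsetD)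
  qed
qed

lemma wedge_foldr_wedge:
  "covector_wedge \<eta> (foldr covector_wedge \<xi>s \<phi>) =
     scale_form ((-1) ^ length \<xi>s) (foldr covector_wedge \<xi>s (covector_wedge \<eta> \<phi>))"
proof (induction \<xi>s)
  case (Cons \<xi> \<xi>s)
  then show ?case
    by (simp add: covector_wedge_anticommute[of \<eta> \<xi>] wedge_simps)
qed simp

text \<open>
  A factor of type \<open>(0,1)\<close> belongs behind the factors of type \<open>(1,0)\<close>, so it has to be moved past
  them at the cost of a sign.
\<close>
lemma pq_fibre_wedge_01:
  assumes \<eta>: "eigen_covector (- \<i>) J \<eta>" and \<phi>: "\<phi> \<in> pq_fibre J p q"
  shows "covector_wedge \<eta> \<phi> \<in> pq_fibre J p (q + 1)"
proof (cases rule: pq_fibre_cases[where p = p and q = q and J = J])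
  case 1
  then show ?thesis using \<phi> by (simp add: wedge_simps pq_fibre_0)
next
  case (2 p' q')
  show ?thesis
  proof (rule form_linear_cspan[OF form_linear_wedge _ subspace_pq_fibre])
    show "\<phi> \<in> cspan (pq_monomials J p' q')" using \<phi> 2 by simp
    fix \<psi> assume "\<psi> \<in> pq_monomials J p' q'"
    then obtain \<xi>s \<eta>s where *: "\<psi> = foldr covector_wedge (\<xi>s @ \<eta>s) unit_form" "length \<xi>s = p'"
      "\<forall>\<xi>\<in>set \<xi>s. eigen_covector \<i> J \<xi>" "length \<eta>s = q'" "\<forall>\<eta>\<in>set \<eta>s. eigen_covector (- \<i>) J \<eta>"
      unfolding pq_monomials_def by blast
    have "foldr covector_wedge (\<xi>s @ \<eta> # \<eta>s) unit_form \<in> pq_monomials J p' (Suc q')"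
      unfolding pq_monomials_def using * \<eta>
      by (intro CollectI exI[of _ "\<xi>s"] exI[of _ "\<eta> # \<eta>s"]) auto
    then have "foldr covector_wedge (\<xi>s @ \<eta> # \<eta>s) unit_form \<in> pq_fibre J p (q + 1)"
      using pq_monomials_subset 2 by (metis of_nat_Suc add.commute subsetD)
    then show "covector_wedge \<eta> \<psi> \<in> pq_fibre J p (q + 1)"
      by (simp add: * wedge_foldr_wedge pq_fibre_scale)
  qed
qed

text \<open>
  The form in which the spanning monomials are used: what holds for the constants, is linear, and
  survives wedge products with covectors of pure type holds on all spaces of \<open>(p,q)\<close>-forms.
\<close>
lemma pq_fibre_induct [consumes 1, case_names subspace unit wedge_10 wedge_01]:
  assumes \<phi>: "\<phi> \<in> pq_fibre J p q"
    and subspace: "\<And>p q. mform.subspace {\<phi>. P p q \<phi>}"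
    and unit: "P 0 0 unit_form"
    and w10: "\<And>p q \<xi> \<phi>. eigen_covector \<i> J \<xi> \<Longrightarrow> \<phi> \<in> pq_fibre J p q \<Longrightarrow> P p q \<phi> \<Longrightarrow>
      P (p + 1) q (covector_wedge \<xi> \<phi>)"
    and w01: "\<And>p q \<eta> \<phi>. eigen_covector (- \<i>) J \<eta> \<Longrightarrow> \<phi> \<in> pq_fibre J p q \<Longrightarrow> P p q \<phi> \<Longrightarrow>
      P p (q + 1) (covector_wedge \<eta> \<phi>)"
  shows "P p q \<phi>"
proof (cases rule: pq_fibre_cases[where p = p and q = q and J = J])
  case 1
  then show ?thesis using \<phi> mform.subspace_0[OF subspace, of p q] by simp
next
  case (2 p' q')
  have 0: "foldr covector_wedge \<eta>s unit_form \<in> pq_fibre J 0 (int (length \<eta>s)) \<and>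
    P 0 (int (length \<eta>s)) (foldr covector_wedge \<eta>s unit_form)"
    if "\<forall>\<eta>\<in>set \<eta>s. eigen_covector (- \<i>) J \<eta>" for \<eta>s
    using that
  proof (induction \<eta>s)
    case Nil then show ?case using unit unit_form_pq_fibre by simp
  next
    case (Cons \<eta> \<eta>s)
    then show ?case
      using w01[of \<eta> "foldr covector_wedge \<eta>s unit_form" 0 "int (length \<eta>s)"]
        pq_fibre_wedge_01[of J \<eta> "foldr covector_wedge \<eta>s unit_form" 0 "int (length \<eta>s)"]
      by (simp add: add.commute)
  qed
  have 1: "foldr covector_wedge (\<xi>s @ \<eta>s) unit_form \<in> pq_fibre J (int (length \<xi>s)) (int (length \<eta>s)) \<and>
    P (int (length \<xi>s)) (int (length \<eta>s)) (foldr covector_wedge (\<xi>s @ \<eta>s) unit_form)"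
    if "\<forall>\<eta>\<in>set \<eta>s. eigen_covector (- \<i>) J \<eta>" "\<forall>\<xi>\<in>set \<xi>s. eigen_covector \<i> J \<xi>" for \<xi>s \<eta>s
    using that(2)
  proof (induction \<xi>s)
    case Nil then show ?case using 0[OF that(1)] by simp
  next
    case (Cons \<xi> \<xi>s)
    then show ?case
      using w10[of \<xi> "foldr covector_wedge (\<xi>s @ \<eta>s) unit_form" "int (length \<xi>s)" "int (length \<eta>s)"]
        pq_fibre_wedge_10[of J \<xi> "foldr covector_wedge (\<xi>s @ \<eta>s) unit_form" "int (length \<xi>s)" "int (length \<eta>s)"]
      by (simp add: add.commute)
  qed
  have "pq_monomials J p' q' \<subseteq> {\<phi>. P p q \<phi>}"
    using 1 2 by (auto simp: pq_monomials_def)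
  then have "cspan (pq_monomials J p' q') \<subseteq> {\<phi>. P p q \<phi>}"
    by (rule cspan_subspaceI) (rule subspace)
  then show ?thesis using \<phi> 2 by auto
qed

lemma eigen_covector_linear: "eigen_covector z J \<xi> \<Longrightarrow> linear \<xi>"
  by (simp add: eigen_covector_def bounded_linear.linear)

lemma alternating_pq_fibre: "\<phi> \<in> pq_fibre J p q \<Longrightarrow> alternating \<phi>"
  by (induction rule: pq_fibre_induct)
     (auto intro: alternating_subspace alternating_unit_form alternating_wedge eigen_covector_linear)

lemma homogeneous_pq_fibre: "\<phi> \<in> pq_fibre J p q \<Longrightarrow> int (length vs) \<noteq> p + q \<Longrightarrow> \<phi> vs = 0"
proof (induction arbitrary: vs rule: pq_fibre_induct)
  case (subspace p q)
  then show ?case by (auto simp: mform.subspace_def scale_form_def)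
next
  case unit
  then show ?case by (auto simp: unit_form_def)
next
  case (wedge_10 p q \<xi> \<phi>)
  then have "\<phi> (omit_nth i vs) = 0" if "i < length vs" for i
    using that by (auto simp: omit_nth_def)
  then show ?case by (simp add: covector_wedge_def)
next
  case (wedge_01 p q \<xi> \<phi>)
  then have "\<phi> (omit_nth i vs) = 0" if "i < length vs" for i
    using that by (auto simp: omit_nth_def)
  then show ?case by (simp add: covector_wedge_def)
qed

lemma half_interior_unit_form: "half_interior z J v unit_form = 0"
  by (auto simp: half_interior_def interior_product_def unit_form_def scale_form_def)

text \<open>
  A vector of type \<open>(1,0)\<close> pairs to zero with covectors of type \<open>(0,1)\<close>; so Cartan's rule removes
  one factor of type \<open>(1,0)\<close> in each term. For \<open>p = 0\<close> the target is the zero space.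
\<close>
lemma pq_fibre_half_interior_10:
  "\<phi> \<in> pq_fibre J p q \<Longrightarrow> half_interior \<i> J v \<phi> \<in> pq_fibre J (p - 1) q"
proof (induction rule: pq_fibre_induct)
  case (subspace p q)
  have "{\<phi>. half_interior \<i> J v \<phi> \<in> pq_fibre J (p - 1) q} = half_interior \<i> J v -` pq_fibre J (p - 1) q"
    by auto
  then show ?case using module_hom.subspace_vimage[OF form_linear_half_interior subspace_pq_fibre] by metis
next
  case unit
  show ?case unfolding half_interior_unit_form by (rule pq_fibre_0)
next
  case (wedge_10 p q \<xi> \<phi>)
  then show ?case
    using pq_fibre_wedge_10[OF wedge_10(1,3)] unfolding half_interior_covector_wedge
    by (intro pq_fibre_diff pq_fibre_scale) auto
next
  case (wedge_01 p q \<eta> \<phi>)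
  then show ?case
    using pq_fibre_neg[OF pq_fibre_wedge_01[OF wedge_01(1,3)]] half_interior_wedge_opposite[OF wedge_01(1)]
    by (simp only: power2_i diff_add_eq)
qed

lemma pq_fibre_half_interior_01:
  "\<phi> \<in> pq_fibre J p q \<Longrightarrow> half_interior (- \<i>) J v \<phi> \<in> pq_fibre J p (q - 1)"
proof (induction rule: pq_fibre_induct)
  case (subspace p q)
  have "{\<phi>. half_interior (-\<i>) J v \<phi> \<in> pq_fibre J p (q - 1)} = half_interior (-\<i>) J v -` pq_fibre J p (q - 1)"
    by auto
  then show ?case using module_hom.subspace_vimage[OF form_linear_half_interior subspace_pq_fibre] by metis
next
  case unit
  show ?case unfolding half_interior_unit_form by (rule pq_fibre_0)
next
  case (wedge_01 p q \<xi> \<phi>)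
  then show ?case
    using pq_fibre_wedge_01[OF wedge_01(1,3)] unfolding half_interior_covector_wedge
    by (intro pq_fibre_diff pq_fibre_scale) auto
next
  case (wedge_10 p q \<eta> \<phi>)
  then show ?case
    using pq_fibre_neg[OF pq_fibre_wedge_10[OF wedge_10(1,3)]]
      half_interior_wedge_opposite[of "- \<i>" J \<eta>]
    by (simp only: power2_minus power2_i minus_minus wedge_10(1) add_diff_eq)
qed

section \<open>Euler operators and the trace of a complex structure\<close>

text \<open>
  A complex structure on a space of real dimension \<open>2n\<close>. The inner product is unrelated to \<open>J\<close>; it
  makes \<open>b \<bullet> v\<close> the coordinates of \<open>v\<close> and these bounded linear.
\<close>
locale linear_complex_structure =
  fixes J :: "'e::real_inner \<Rightarrow>\<^sub>L 'e" and B :: "'e set" and n :: nat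
  assumes J_J [simp]: "J (J v) = - v"
    and finite_B [simp]: "finite B" and card_B: "card B = 2 * n"
    and unit_B: "\<And>b. b \<in> B \<Longrightarrow> b \<bullet> b = 1"
    and expand: "v = (\<Sum>b\<in>B. (b \<bullet> v) *\<^sub>R b)"
begin

abbreviation dual :: "'e \<Rightarrow> 'e \<Rightarrow> complex" where
  "dual b \<equiv> (\<lambda>v. complex_of_real (b \<bullet> v))"

definition half_dual :: "complex \<Rightarrow> 'e \<Rightarrow> 'e \<Rightarrow> complex" where
  "half_dual z b = half_covector z J (dual b)"

text \<open>
  Up to the factor 4, this is the derivation \<open>\<Sum>\<theta>\<^sub>j \<and> \<iota>(e\<^sub>j)\<close> for dual complex bases of covectors
  and vectors of type \<open>(1,0)\<close>, or of type \<open>(0,1)\<close>: a derivation that counts the factors of one type.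
\<close>
definition half_euler :: "complex \<Rightarrow> 'e mform \<Rightarrow> 'e mform" where
  "half_euler z \<phi> = (\<Sum>b\<in>B. covector_wedge (half_dual z b) (half_interior z J b \<phi>))"

definition trace_J :: real where "trace_J = (\<Sum>b\<in>B. b \<bullet> J b)"

lemma bounded_linear_dual: "bounded_linear (dual b)"
  by (intro bounded_linear_compose[OF bounded_linear_of_real] bounded_linear_inner_right)

lemma eigen_half_dual: "z\<^sup>2 = -1 \<Longrightarrow> eigen_covector z J (half_dual z b)"
  unfolding half_dual_def by (rule eigen_covector_half_covector[OF bounded_linear_dual]) auto

lemma expand_linear:
  assumes "linear f" shows "f v = (\<Sum>b\<in>B. (b \<bullet> v) *\<^sub>R f b)"
  using arg_cong[OF expand[of v], of f] by (simp add: linear_sum[OF assms] linear_scale[OF assms])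

lemma half_dual_sum:
  assumes "eigen_covector z J \<xi>" "z\<^sup>2 = -1"
  shows "(\<Sum>b\<in>B. \<xi> b * half_dual z b v) = 2 * \<xi> v"
proof -
  have "(\<Sum>b\<in>B. \<xi> b * half_dual z b v) = (\<Sum>b\<in>B. (b \<bullet> v) *\<^sub>R \<xi> b) - z * (\<Sum>b\<in>B. (b \<bullet> J v) *\<^sub>R \<xi> b)"
    unfolding sum_distrib_left sum_subtractf[symmetric]
    by (rule sum.cong) (simp_all add: half_dual_def half_covector_def scaleR_conv_of_real algebra_simps)
  also have "\<dots> = half_covector z J \<xi> v"
    unfolding half_covector_def expand_linear[OF eigen_covector_linear[OF assms(1)], symmetric] ..
  finally show ?thesis using half_covector_eigen[OF assms] by simp
qed

lemma form_linear_half_euler: "form_linear (half_euler z)"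
  by (rule form_linearI)
     (simp_all add: half_euler_def half_interior_simps wedge_simps sum.distrib mform.scale_sum_right)

text \<open>
  The derivation property, in which the factor \<open>\<xi>\<close> is an eigenvector: two factors 2 come from the
  half vector and the half covector.
\<close>
lemma half_euler_wedge:
  assumes \<xi>: "eigen_covector z J \<xi>" and z: "z\<^sup>2 = -1"
  shows "half_euler z (covector_wedge \<xi> \<phi>) = scale_form 4 (covector_wedge \<xi> \<phi>) + covector_wedge \<xi> (half_euler z \<phi>)"
proof -
  have "half_euler z (covector_wedge \<xi> \<phi>) =
      (\<Sum>b\<in>B. covector_wedge (\<lambda>v. 2 * (\<xi> b * half_dual z b v)) \<phi>) -
      (\<Sum>b\<in>B. covector_wedge (half_dual z b) (covector_wedge \<xi> (half_interior z J b \<phi>)))"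
    unfolding half_euler_def
    by (simp only: half_interior_covector_wedge half_covector_eigen[OF assms] wedge_simps sum_subtractf
        covector_wedge_scale_left mform.scale_scale)
  also have "(\<Sum>b\<in>B. covector_wedge (\<lambda>v. 2 * (\<xi> b * half_dual z b v)) \<phi>) =
      covector_wedge (\<lambda>v. 2 * (\<Sum>b\<in>B. \<xi> b * half_dual z b v)) \<phi>"
    by (simp only: flip: covector_wedge_sum_left sum_distrib_left)
  also have "\<dots> = scale_form 4 (covector_wedge \<xi> \<phi>)"
    by (simp only: half_dual_sum[OF assms] flip: covector_wedge_scale_left) (simp add: mult.assoc[symmetric])
  also have "(\<Sum>b\<in>B. covector_wedge (half_dual z b) (covector_wedge \<xi> (half_interior z J b \<phi>))) =
      - covector_wedge \<xi> (half_euler z \<phi>)"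
    by (simp only: half_euler_def wedge_simps covector_wedge_anticommute[of "half_dual z _" \<xi>] sum_negf)
  finally show ?thesis by (simp only: diff_minus_eq_add)
qed

lemma half_euler_wedge_opposite:
  assumes \<xi>: "eigen_covector (- z) J \<xi>" and z: "z\<^sup>2 = -1"
  shows "half_euler z (covector_wedge \<xi> \<phi>) = covector_wedge \<xi> (half_euler z \<phi>)"
  unfolding half_euler_def
  by (simp only: half_interior_covector_wedge half_covector_opposite_eigen[OF assms] wedge_simps
      mform.scale_zero_left diff_0 covector_wedge_anticommute[of "half_dual z _" \<xi>] minus_minus)

lemma half_euler_unit_form: "half_euler z unit_form = 0"
  by (simp only: half_euler_def half_interior_unit_form wedge_simps sum.neutral_const)

lemma subspace_eigen:
  assumes "form_linear f" shows "mform.subspace {\<phi>. f \<phi> = scale_form c \<phi>}"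
  using assms by (auto simp: mform.subspace_def module_hom.add module_hom.scale module_hom.zero
      mform.scale_right_distrib mult.commute)

lemma half_euler_10: "\<phi> \<in> pq_fibre J p q \<Longrightarrow> half_euler \<i> \<phi> = scale_form (4 * of_int p) \<phi>"
proof (induction rule: pq_fibre_induct)
  case (subspace p q) show ?case by (rule subspace_eigen[OF form_linear_half_euler])
next
  case unit show ?case by (simp add: half_euler_unit_form)
next
  case (wedge_10 p q \<xi> \<phi>)
  show ?case
    by (simp only: half_euler_wedge[OF wedge_10(1) i_squared[folded power2_eq_square]] wedge_10 wedge_simps
        flip: mform.scale_left_distrib) (simp add: algebra_simps)
next
  case (wedge_01 p q \<xi> \<phi>)
  then show ?case by (simp add: half_euler_wedge_opposite wedge_simps)
qed

lemma half_euler_01: "\<phi> \<in> pq_fibre J p q \<Longrightarrow> half_euler (-\<i>) \<phi> = scale_form (4 * of_int q) \<phi>"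
proof (induction rule: pq_fibre_induct)
  case (subspace p q) show ?case by (rule subspace_eigen[OF form_linear_half_euler])
next
  case unit show ?case by (simp add: half_euler_unit_form)
next
  case (wedge_01 p q \<xi> \<phi>)
  have "(- \<i>)\<^sup>2 = -1" by simp
  show ?case
    by (simp only: half_euler_wedge[OF wedge_01(1) \<open>(-\<i>)\<^sup>2 = -1\<close>] wedge_01 wedge_simps
        flip: mform.scale_left_distrib) (simp add: algebra_simps)
next
  case (wedge_10 p q \<xi> \<phi>)
  then show ?case by (simp add: half_euler_wedge_opposite wedge_simps)
qed

text \<open>
  The Euler operator with its factors in the opposite order. As contractions and wedge products
  anticommute up to the pairing, the two orders add up to the constant \<open>\<Sum>\<langle>\<theta>\<^sub>b, b - zJb\<rangle>\<close>, which
  involves the trace of \<open>J\<close>.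
\<close>
lemma half_euler_dual:
  assumes z: "z\<^sup>2 = -1"
  shows "(\<Sum>b\<in>B. half_interior z J b (covector_wedge (half_dual z b) \<phi>)) =
    scale_form (4 * of_nat n - 2 * z * trace_J) \<phi> - half_euler z \<phi>"
proof -
  have "half_dual z b b = 1 - z * (b \<bullet> J b)" if "b \<in> B" for b
    using unit_B[OF that] by (simp add: half_dual_def half_covector_def)
  then have "(\<Sum>b\<in>B. half_covector z J (half_dual z b) b) = (\<Sum>b\<in>B. 2 * (1 - z * (b \<bullet> J b)))"
    by (intro sum.cong refl) (simp add: half_covector_eigen[OF eigen_half_dual[OF z] z])
  also have "\<dots> = 4 * of_nat n - 2 * z * trace_J"
    by (simp add: sum_subtractf sum_distrib_left card_B trace_J_def algebra_simps flip: sum_distrib_left)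
  finally have *: "(\<Sum>b\<in>B. half_covector z J (half_dual z b) b) = 4 * of_nat n - 2 * z * trace_J" .
  show ?thesis
    by (simp only: half_interior_covector_wedge sum_subtractf half_euler_def * flip: mform.scale_sum_left)
qed

text \<open>
  Expanding all arguments in the basis leaves lists of basis vectors that are longer than the
  basis, hence have a repetition. In the induction, \<open>us\<close> collects the arguments already expanded.
\<close>
lemma alternating_vanishes:
  fixes \<phi> :: "'e mform"
  assumes a: "alternating \<phi>" and l: "length vs > card B"
  shows "\<phi> vs = 0"
proof -
  have "\<phi> (us @ vs) = 0" if "set us \<subseteq> B" "length us + length vs > card B" for us
    using that
  proof (induction vs arbitrary: us)
    case Nil
    have "\<not> distinct us"
      using Nil card_mono[OF finite_B Nil(1)] distinct_card by fastforce
    then show ?case using a by (simp add: alternating_def)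
  next
    case (Cons v vs)
    have "linear (\<lambda>v. \<phi> (us @ v # vs))" using a unfolding alternating_def by blast
    from expand_linear[OF this, of v]
    have "\<phi> (us @ v # vs) = (\<Sum>b\<in>B. (b \<bullet> v) *\<^sub>R \<phi> (us @ b # vs))" .
    also have "\<dots> = 0"
    proof (rule sum.neutral, rule ballI)
      fix b assume "b \<in> B"
      then have "\<phi> ((us @ [b]) @ vs) = 0" using Cons.prems by (intro Cons.IH) auto
      then show "(b \<bullet> v) *\<^sub>R \<phi> (us @ b # vs) = 0" by simp
    qed
    finally show ?case .
  qed
  from this[of "[]"] l show ?thesis by simp
qed

lemma pq_fibre_large_degree: "p + q > 2 * int n \<Longrightarrow> pq_fibre J p q = {0}"
proof (intro equalityI subsetI)
  fix \<phi> assume pq: "p + q > 2 * int n" and \<phi>: "\<phi> \<in> pq_fibre J p q"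
  have "\<phi> vs = 0" for vs
    using homogeneous_pq_fibre[OF \<phi>, of vs] alternating_vanishes[OF alternating_pq_fibre[OF \<phi>], of vs] pq card_B
    by linarith
  then show "\<phi> \<in> {0}" by auto
qed (auto intro: pq_fibre_0)

lemma half_euler_10_dual:
  assumes \<phi>: "\<phi> \<in> pq_fibre J p q"
  shows "(\<Sum>b\<in>B. half_interior \<i> J b (covector_wedge (half_dual \<i> b) \<phi>)) =
    scale_form (4 * (of_nat n - of_int p) - 2 * \<i> * trace_J) \<phi>"
  by (simp only: half_euler_dual[OF i_squared[folded power2_eq_square]] half_euler_10[OF \<phi>]
      flip: mform.scale_left_diff_distrib) (simp add: algebra_simps)

text \<open>
  If there are no forms of type \<open>(p + 1, q)\<close>, then the operator of \<open>half_euler_10_dual\<close> vanishes on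
  those of type \<open>(p,q)\<close>, although it is multiplication by a number.
\<close>
lemma half_euler_10_top:
  assumes \<phi>: "\<phi> \<in> pq_fibre J p q" and 0: "pq_fibre J (p + 1) q = {0}"
  shows "scale_form (4 * (of_nat n - of_int p) - 2 * \<i> * trace_J) \<phi> = 0"
proof -
  have "covector_wedge (half_dual \<i> b) \<phi> = 0" for b
    using pq_fibre_wedge_10[OF eigen_half_dual \<phi>, of b] 0 by simp
  then show ?thesis
    unfolding half_euler_10_dual[OF \<phi>, symmetric] by (simp add: half_interior_simps)
qed

lemma unit_form_nonzero: "unit_form \<noteq> 0"
  by (auto simp: fun_eq_iff unit_form_def)

text \<open>
  Take the largest \<open>p\<close> with a nonzero form of type \<open>(p,0)\<close>; it exists because \<open>(0,0)\<close> is such a type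
  and alternating forms of degree above \<open>2n\<close> vanish. By \<open>half_euler_10_top\<close> the number
  \<open>4(n - p) - 2\<i>\<cdot>trace_J\<close> is zero, and so is its imaginary part.
\<close>
lemma trace_J_0: "trace_J = 0"
proof -
  define p where "p = (GREATEST p. pq_fibre J (int p) 0 \<noteq> {0})"
  have 0: "pq_fibre J (int 0) 0 \<noteq> {0}" using unit_form_pq_fibre[of J] unit_form_nonzero by auto
  have bd: "p \<le> 2 * n" if "pq_fibre J (int p) 0 \<noteq> {0}" for p
    using that pq_fibre_large_degree[of "int p" 0] by (cases "p \<le> 2 * n") simp_all
  have "pq_fibre J (int p) 0 \<noteq> {0}" unfolding p_def
    by (rule GreatestI_nat[where P = "\<lambda>p. pq_fibre J (int p) 0 \<noteq> {0}", OF 0 bd])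
  moreover have "pq_fibre J (int p + 1) 0 = {0}"
  proof (rule ccontr)
    assume "pq_fibre J (int p + 1) 0 \<noteq> {0}"
    then have "pq_fibre J (int (Suc p)) 0 \<noteq> {0}" by (simp add: add.commute)
    then have "Suc p \<le> p" unfolding p_def
      by (rule Greatest_le_nat[where P = "\<lambda>p. pq_fibre J (int p) 0 \<noteq> {0}"]) (rule bd)
    then show False by simp
  qed
  moreover from calculation pq_fibre_0[of J "int p" 0]
  obtain \<phi> where \<phi>: "\<phi> \<in> pq_fibre J (int p) 0" "\<phi> \<noteq> 0" by auto
  ultimately have "scale_form (4 * (of_nat n - of_int (int p)) - 2 * \<i> * trace_J) \<phi> = 0"
    using half_euler_10_top[OF \<phi>(1)] by simp
  then have "4 * (of_nat n - of_int (int p)) - 2 * \<i> * trace_J = 0"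
    using \<phi>(2) mform.scale_eq_0_iff by blast
  from arg_cong[OF this, of Im] show ?thesis by simp
qed

text \<open>
  Downward induction on \<open>p\<close>, starting above degree \<open>2n\<close>: by \<open>half_euler_10_top\<close> the nonzero number
  \<open>4(n - p)\<close> annihilates the \<open>(p,q)\<close>-forms as soon as there are none of type \<open>(p + 1, q)\<close>.
\<close>
lemma pq_fibre_large_p:
  assumes "p > int n" shows "pq_fibre J p q = {0}"
proof (cases "q < 0")
  case True then show ?thesis by (simp add: pq_fibre_negative)
next
  case False
  show ?thesis
    using assms
  proof (induction "nat (2 * int n + 1 - p)" arbitrary: p rule: less_induct)
    case (less p)
    show ?case
    proof (cases "p > 2 * int n")
      case True then show ?thesis using False by (intro pq_fibre_large_degree) simp
    next
      case le: False
      then have 0: "pq_fibre J (p + 1) q = {0}" using less.prems by (intro less.hyps) auto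
      have "\<phi> = 0" if \<phi>: "\<phi> \<in> pq_fibre J p q" for \<phi>
      proof -
        have "4 * (of_nat n - of_int p) - 2 * \<i> * trace_J = of_int (4 * (int n - p))"
          by (simp add: trace_J_0)
        moreover have "\<dots> \<noteq> (0 :: complex)" using less.prems by (simp only: of_int_eq_0_iff) simp
        ultimately show ?thesis
          using half_euler_10_top[OF \<phi> 0] by (metis mform.scale_eq_0_iff)
      qed
      then show ?thesis using pq_fibre_0 by blast
    qed
  qed
qed

end

section \<open>The spaces U^k of an almost-complex structure\<close>

lemma form_linear_clifford: "form_linear (clifford w)"
proof (rule form_linearI)
  show "clifford w (\<phi> + \<psi>) = clifford w \<phi> + clifford w \<psi>" for \<phi> \<psi>
    by (simp add: clifford_def real_clifford_def interior_simps wedge_simps fun_eq_iff algebra_simps)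
  show "clifford w (scale_form z \<phi>) = scale_form z (clifford w \<phi>)" for z \<phi>
    by (simp add: clifford_def real_clifford_def interior_simps wedge_simps)
      (simp add: scale_form_def fun_eq_iff algebra_simps)
qed

lemma clifford_eq:
  "clifford ((x, \<xi>), (y, \<eta>)) \<phi> = interior_product x \<phi> + scale_form \<i> (interior_product y \<phi>) +
     covector_wedge (\<lambda>v. complex_of_real (\<xi> v) + \<i> * complex_of_real (\<eta> v)) \<phi>"
  by (simp only: covector_wedge_add_left covector_wedge_scale_left)
     (simp add: clifford_def real_clifford_def scale_form_def fun_eq_iff algebra_simps)

lemma i_eigenspace_gacs_fibre:
  fixes J :: "'e::real_normed_vector \<Rightarrow>\<^sub>L 'e"
  assumes "\<And>v. J (J v) = - v"
  shows "i_eigenspace (gacs_fibre J) = {((v, \<xi>), (J v, - (\<xi> o\<^sub>L J))) | v \<xi>. True}"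
proof -
  have [simp]: "(\<xi> o\<^sub>L J) o\<^sub>L J = - \<xi>" "(- \<xi>) o\<^sub>L J = - (\<xi> o\<^sub>L J)" for \<xi> :: "'e \<Rightarrow>\<^sub>L real"
    by (auto intro!: blinfun_eqI simp: assms blinfun.minus_right blinfun.minus_left)
  show ?thesis
    by (auto simp: i_eigenspace_def gacs_fibre_apply assms blinfun.minus_right)
qed

lemma half_interior_interior:
  assumes "alternating \<phi>"
  shows "half_interior z J v (interior_product x \<phi>) = - interior_product x (half_interior z J v \<phi>)"
  by (simp only: half_interior_def interior_simps interior_anticommute[OF assms, of _ x]
      mform.scale_minus_right minus_diff_minus)

lemma subspace_U_fibre: "mform.subspace (U_fibre n T k)"
  by (simp add: U_fibre_def subspace_cspan mform.subspace_single_0)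

lemma U_fibre_clifford:
  assumes \<phi>: "\<phi> \<in> U_fibre n T (k + 1)" and w: "w \<in> cconj ` i_eigenspace T"
  shows "clifford w \<phi> \<in> U_fibre n T k"
proof (cases "k + 1 \<le> int n")
  case False
  then have "clifford w \<phi> = 0"
    using \<phi> module_hom.zero[OF form_linear_clifford] by (simp add: U_fibre_def)
  then show ?thesis by (simp only: mform.subspace_0[OF subspace_U_fibre])
next
  case True
  show ?thesis
  proof (rule form_linear_cspan[OF form_linear_clifford _ subspace_U_fibre])
    show "\<phi> \<in> cspan {foldr clifford ws \<rho> | ws \<rho>.
             length ws = nat (int n - (k + 1)) \<and> set ws \<subseteq> cconj ` i_eigenspace T \<and> \<rho> \<in> canonical_line T}"
      using \<phi> True by (simp add: U_fibre_def)
    fix \<psi> assume "\<psi> \<in> {foldr clifford ws \<rho> | ws \<rho>.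
             length ws = nat (int n - (k + 1)) \<and> set ws \<subseteq> cconj ` i_eigenspace T \<and> \<rho> \<in> canonical_line T}"
    then obtain ws \<rho> where *: "\<psi> = foldr clifford ws \<rho>" "length ws = nat (int n - (k + 1))"
      "set ws \<subseteq> cconj ` i_eigenspace T" "\<rho> \<in> canonical_line T" by blast
    have "clifford w \<psi> \<in> {foldr clifford ws \<rho> | ws \<rho>.
             length ws = nat (int n - k) \<and> set ws \<subseteq> cconj ` i_eigenspace T \<and> \<rho> \<in> canonical_line T}"
      using * w True by (intro CollectI exI[of _ "w # ws"] exI[of _ \<rho>]) auto
    then show "clifford w \<psi> \<in> U_fibre n T k"
      using True by (simp add: U_fibre_def cspan_eq_span mform.span_base)
  qed
qed

context linear_complex_structure begin

text \<open>
  Elements of \<open>L\<close> act by a contraction with a vector of type \<open>(0,1)\<close> plus a wedge product with a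
  covector of type \<open>(1,0)\<close>; for the conjugate of \<open>L\<close> the types are interchanged.
\<close>
lemma clifford_eigen:
  "clifford ((v, \<xi>), (J v, - (\<xi> o\<^sub>L J))) \<phi> =
     half_interior (- \<i>) J v \<phi> + covector_wedge (half_covector \<i> J (\<lambda>v. complex_of_real (\<xi> v))) \<phi>"
  by (simp add: clifford_eq half_interior_def half_covector_def[abs_def] blinfun.minus_left)

lemma clifford_conj_eigen:
  assumes "alternating \<phi>"
  shows "clifford ((v, \<xi>), (- J v, \<xi> o\<^sub>L J)) \<phi> =
     half_interior \<i> J v \<phi> + covector_wedge (half_covector (- \<i>) J (\<lambda>v. complex_of_real (\<xi> v))) \<phi>"
proof -
  have "multilinear_form \<phi>" using assms by (simp add: alternating_iff_adjacent)
  from interior_scale_vector[OF this, of "-1" "J v"]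
  have "interior_product (- J v) \<phi> = - interior_product (J v) \<phi>" by simp
  then show ?thesis
    by (simp add: clifford_eq half_interior_def half_covector_def[abs_def])
qed

lemma cconj_i_eigenspace:
  "cconj ` i_eigenspace (gacs_fibre J) = {((v, \<xi>), (- J v, \<xi> o\<^sub>L J)) | v \<xi>. True}"
  by (force simp: i_eigenspace_gacs_fibre[OF J_J] cconj_def)

lemma bounded_linear_covector: "bounded_linear (\<lambda>v. complex_of_real (blinfun_apply \<xi> v))"
  by (intro bounded_linear_compose[OF bounded_linear_of_real] blinfun.bounded_linear_right)

lemma eigen_half_blinfun:
  "z\<^sup>2 = -1 \<Longrightarrow> eigen_covector z J (half_covector z J (\<lambda>v. complex_of_real (blinfun_apply \<xi> v)))"
  by (rule eigen_covector_half_covector[OF bounded_linear_covector]) auto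

lemma eq_0_if_inner_B: "(\<And>b. b \<in> B \<Longrightarrow> b \<bullet> v = 0) \<Longrightarrow> v = 0"
  using expand[of v] by simp

text \<open>
  For bidegree reasons \<open>L\<close> annihilates \<open>\<phi>\<close>. Conversely let \<open>w\<close> annihilate \<open>\<phi>\<close>. Applying to \<open>w \<cdot> \<phi> = 0\<close>
  an element \<open>l\<close> of \<open>L\<close> gives \<open>2\<langle>l | w\<rangle>\<phi> = 0\<close>, as the Clifford action of \<open>l\<close> kills \<open>\<phi>\<close>. So \<open>w\<close> is orthogonal
  to \<open>L\<close>, and \<open>L\<close> is its own orthogonal complement.
\<close>
lemma annihilator_eq:
  assumes \<phi>: "\<phi> \<in> pq_fibre J (int n) 0" and nz: "\<phi> \<noteq> 0"
  shows "annihilator \<phi> = i_eigenspace (gacs_fibre J)"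
proof -
  have alt: "alternating \<phi>" using \<phi> by (rule alternating_pq_fibre)
  have i0: "half_interior (- \<i>) J v \<phi> = 0" for v
    using pq_fibre_half_interior_01[OF \<phi>, of v] by (simp add: pq_fibre_negative)
  have w0: "covector_wedge \<xi> \<phi> = 0" if "eigen_covector \<i> J \<xi>" for \<xi>
    using pq_fibre_wedge_10[OF that \<phi>] by (simp add: pq_fibre_large_p)
  show ?thesis
  proof (intro equalityI subsetI)
    fix w assume "w \<in> i_eigenspace (gacs_fibre J)"
    then obtain v \<xi> where "w = ((v, \<xi>), (J v, - (\<xi> o\<^sub>L J)))"
      unfolding i_eigenspace_gacs_fibre[OF J_J] by blast
    then show "w \<in> annihilator \<phi>"
      by (simp add: annihilator_def clifford_eigen i0 w0 eigen_half_blinfun)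
  next
    fix w assume w: "w \<in> annihilator \<phi>"
    obtain x \<xi> y \<eta> where w_eq: "w = ((x, \<xi>), (y, \<eta>))" by (metis surj_pair)
    define \<zeta> where "\<zeta> = (\<lambda>v. complex_of_real (\<xi> v) + \<i> * complex_of_real (\<eta> v))"
    have c: "interior_product x \<phi> + scale_form \<i> (interior_product y \<phi>) + covector_wedge \<zeta> \<phi> = 0"
      using w unfolding annihilator_def w_eq \<zeta>_def clifford_eq[symmetric] by blast
    \<comment> \<open>The covectors in \<open>L\<close> test the vector part of \<open>w\<close>, and the vectors in \<open>L\<close> its covector part.\<close>
    have "b \<bullet> (y - J x) = 0" for b
    proof -
      let ?t = "half_dual \<i> b"
      have t: "eigen_covector \<i> J ?t" by (rule eigen_half_dual) simp
      have "covector_wedge ?t (interior_product v \<phi>) = scale_form (?t v) \<phi>" for v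
        using interior_covector_wedge[of v ?t \<phi>] by (simp only: w0[OF t] interior_simps) simp
      moreover have "covector_wedge ?t (covector_wedge \<zeta> \<phi>) = 0"
        by (simp only: covector_wedge_anticommute[of ?t] w0[OF t] wedge_simps minus_zero)
      ultimately have "scale_form (?t x + \<i> * ?t y) \<phi> = 0"
        using arg_cong[OF c, of "covector_wedge ?t"]
        by (simp only: wedge_simps mform.scale_scale mform.scale_left_distrib add_0_right)
      then have "?t x + \<i> * ?t y = 0" using nz mform.scale_eq_0_iff by blast
      from arg_cong[OF this, of Im] show ?thesis
        by (simp add: half_dual_def half_covector_def inner_diff_right)
    qed
    from eq_0_if_inner_B[OF this] have y: "y = J x" by simp
    have "\<eta> v = - \<xi> (J v)" for v
    proof -
      have "half_interior (- \<i>) J v (interior_product u \<phi>) = 0" for u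
        by (simp only: half_interior_interior[OF alt] i0 interior_simps minus_zero)
      moreover have "half_interior (- \<i>) J v (covector_wedge \<zeta> \<phi>) = scale_form (half_covector (- \<i>) J \<zeta> v) \<phi>"
        by (simp only: half_interior_covector_wedge i0 wedge_simps diff_zero)
      ultimately have "scale_form (half_covector (- \<i>) J \<zeta> v) \<phi> = 0"
        using arg_cong[OF c, of "half_interior (- \<i>) J v"]
        by (simp only: half_interior_simps mform.scale_zero_right add_0_left)
      then have "half_covector (- \<i>) J \<zeta> v = 0" using nz mform.scale_eq_0_iff by blast
      from arg_cong[OF this, of Im] show ?thesis
        by (simp add: half_covector_def \<zeta>_def)
    qed
    then have "\<eta> = - (\<xi> o\<^sub>L J)"
      by (intro blinfun_eqI) (simp add: blinfun.minus_left)
    then show "w \<in> i_eigenspace (gacs_fibre J)"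
      unfolding i_eigenspace_gacs_fibre[OF J_J] w_eq y by blast
  qed
qed

text \<open>The classical Euler operator, whose eigenvalue is the degree.\<close>
lemma euler_degree:
  assumes "alternating \<phi>"
  shows "(\<Sum>b\<in>B. covector_wedge (dual b) (interior_product b \<phi>)) vs = of_nat (length vs) * \<phi> vs"
  using assms
proof (induction vs arbitrary: \<phi>)
  case Nil then show ?case by (simp add: sum_form_apply)
next
  case (Cons v vs)
  have "linear (\<lambda>v. \<phi> ([] @ v # vs))" using Cons.prems unfolding alternating_def by blast
  from expand_linear[OF this, of v]
  have "(\<Sum>b\<in>B. dual b v * interior_product b \<phi> vs) = \<phi> (v # vs)"
    by (simp add: interior_product_def scaleR_conv_of_real)
  moreover have "(\<Sum>b\<in>B. covector_wedge (dual b) (interior_product v (interior_product b \<phi>)) vs) =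
      - (of_nat (length vs) * \<phi> (v # vs))"
    using Cons.IH[OF alternating_interior[OF Cons.prems], of v]
    by (simp add: interior_anticommute[OF Cons.prems, of v] wedge_simps sum_negf sum_form_apply)
       (simp add: interior_product_def)
  ultimately show ?case
    by (simp add: sum_form_apply covector_wedge_Cons sum_subtractf algebra_simps)
qed

text \<open>Both sides contract the tensor \<open>J\<close>, written once in the dual basis and once in the basis.\<close>
lemma euler_sum_transfer_J:
  assumes m: "multilinear_form \<phi>"
  shows "(\<Sum>b\<in>B. covector_wedge (\<lambda>v. dual b (J v)) (interior_product b \<phi>)) =
    (\<Sum>b\<in>B. covector_wedge (dual b) (interior_product (J b) \<phi>))"
proof -
  have *: "(\<lambda>v. \<Sum>b\<in>B. complex_of_real (c \<bullet> J b) * dual b v) = (\<lambda>v. dual c (J v))" for c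
  proof
    fix v
    have "linear (\<lambda>v. c \<bullet> J v)"
      by (intro bounded_linear.linear bounded_linear_compose[OF bounded_linear_inner_right]
          blinfun.bounded_linear_right)
    from expand_linear[OF this, of v] show "(\<Sum>b\<in>B. complex_of_real (c \<bullet> J b) * dual b v) = dual c (J v)"
      by (simp add: mult.commute)
  qed
  have "interior_product (J b) \<phi> = (\<Sum>c\<in>B. scale_form (c \<bullet> J b) (interior_product c \<phi>))" for b
    by (subst expand[of "J b"]) (rule interior_sum_vector[OF m])
  then have "(\<Sum>b\<in>B. covector_wedge (dual b) (interior_product (J b) \<phi>)) =
    (\<Sum>b\<in>B. \<Sum>c\<in>B. covector_wedge (\<lambda>v. complex_of_real (c \<bullet> J b) * dual b v) (interior_product c \<phi>))"
    by (simp only: wedge_simps covector_wedge_scale_left)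
  also have "\<dots> = (\<Sum>c\<in>B. \<Sum>b\<in>B. covector_wedge (\<lambda>v. complex_of_real (c \<bullet> J b) * dual b v) (interior_product c \<phi>))"
    by (rule sum.swap)
  also have "\<dots> = (\<Sum>c\<in>B. covector_wedge (\<lambda>v. \<Sum>b\<in>B. complex_of_real (c \<bullet> J b) * dual b v) (interior_product c \<phi>))"
    by (simp only: covector_wedge_sum_left)
  finally show ?thesis by (simp only: *)
qed

lemma half_dual_wedge:
  "covector_wedge (half_dual z b) \<phi> =
    covector_wedge (dual b) \<phi> - scale_form z (covector_wedge (\<lambda>v. dual b (J v)) \<phi>)"
proof -
  have "half_dual z b = (\<lambda>v. dual b v + (- z) * dual b (J v))"
    by (auto simp: half_dual_def half_covector_def)
  then show ?thesis by (simp only: covector_wedge_add_left covector_wedge_scale_left) simp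
qed

text \<open>
  On forms without factors of type \<open>(0,1)\<close>, expressed as vanishing of the contractions with vectors
  of type \<open>(0,1)\<close>, counting factors of type \<open>(1,0)\<close> is counting all factors. The 2 stems from the half covector.
\<close>
lemma half_dual_euler_degree:
  assumes alt: "alternating \<rho>" and i0: "\<And>v. half_interior (- \<i>) J v \<rho> = 0"
  shows "(\<Sum>b\<in>B. covector_wedge (half_dual \<i> b) (interior_product b \<rho>)) vs = 2 * of_nat (length vs) * \<rho> vs"
proof -
  have m: "multilinear_form \<rho>" using alt by (simp add: alternating_iff_adjacent)
  have i: "scale_form \<i> (interior_product (J b) \<rho>) = - interior_product b \<rho>" for b
    using i0[of b] by (simp add: half_interior_def eq_neg_iff_add_eq_0 add.commute)
  have "(\<Sum>b\<in>B. covector_wedge (half_dual \<i> b) (interior_product b \<rho>)) =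
    (\<Sum>b\<in>B. covector_wedge (dual b) (interior_product b \<rho>)) -
    scale_form \<i> (\<Sum>b\<in>B. covector_wedge (\<lambda>v. dual b (J v)) (interior_product b \<rho>))"
    by (simp only: half_dual_wedge sum_subtractf mform.scale_sum_right)
  also have "scale_form \<i> (\<Sum>b\<in>B. covector_wedge (\<lambda>v. dual b (J v)) (interior_product b \<rho>)) =
    - (\<Sum>b\<in>B. covector_wedge (dual b) (interior_product b \<rho>))"
    by (simp only: euler_sum_transfer_J[OF m] mform.scale_sum_right module_hom.scale[OF form_linear_wedge, symmetric]
        i wedge_simps sum_negf)
  finally show ?thesis using euler_degree[OF alt] by simp
qed

text \<open>
  By \<open>half_dual_euler_degree\<close> such a form of positive degree is a combination of wedge products of
  covectors of type \<open>(1,0)\<close> with its own contractions, to which induction applies.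
\<close>
lemma pq_fibre_0I:
  assumes alt: "alternating \<rho>" and i0: "\<And>v. half_interior (- \<i>) J v \<rho> = 0"
    and h: "\<And>vs. length vs \<noteq> j \<Longrightarrow> \<rho> vs = 0"
  shows "\<rho> \<in> pq_fibre J (int j) 0"
  using assms
proof (induction j arbitrary: \<rho>)
  case 0
  then have "\<rho> = scale_form (\<rho> []) unit_form"
    by (auto simp: scale_form_def unit_form_def fun_eq_iff)
  then show ?case using pq_fibre_scale[OF unit_form_pq_fibre] by (metis of_nat_0)
next
  case (Suc j)
  have "interior_product b \<rho> \<in> pq_fibre J (int j) 0" for b
  proof (rule Suc.IH)
    show "half_interior (- \<i>) J v (interior_product b \<rho>) = 0" for v
      by (simp only: half_interior_interior[OF Suc.prems(1)] Suc.prems(2) interior_simps minus_zero)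
    show "alternating (interior_product b \<rho>)" by (rule alternating_interior[OF Suc.prems(1)])
    show "interior_product b \<rho> vs = 0" if "length vs \<noteq> j" for vs
      using that Suc.prems(3) by (simp add: interior_product_def)
  qed
  then have "covector_wedge (half_dual \<i> b) (interior_product b \<rho>) \<in> pq_fibre J (int j + 1) 0" for b
    by (intro pq_fibre_wedge_10 eigen_half_dual) simp_all
  then have 1: "scale_form (1 / (2 * of_nat (Suc j)))
      (\<Sum>b\<in>B. covector_wedge (half_dual \<i> b) (interior_product b \<rho>)) \<in> pq_fibre J (int j + 1) 0"
    by (intro pq_fibre_scale pq_fibre_sum)
  have nz: "2 * of_nat (Suc j) \<noteq> (0 :: complex)" by (simp only: mult_eq_0_iff of_nat_eq_0_iff) simp
  have "\<rho> vs = 1 / (2 * of_nat (Suc j)) * (2 * of_nat (length vs) * \<rho> vs)" for vs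
    using Suc.prems(3)[of vs] nz by (cases "length vs = Suc j") auto
  then have "\<rho> = scale_form (1 / (2 * of_nat (Suc j)))
      (\<Sum>b\<in>B. covector_wedge (half_dual \<i> b) (interior_product b \<rho>))"
    by (intro ext) (simp only: scale_form_def half_dual_euler_degree[OF Suc.prems(1,2)])
  then show ?case using 1 by (simp add: add.commute)
qed

text \<open>
  The vectors in the annihilator leave only the types \<open>(j,0)\<close>. As the covectors in it kill \<open>\<rho>\<close>,
  Cartan's rule turns the sum in \<open>half_dual_euler_degree\<close> into the multiple of \<open>\<rho>\<close> by
  \<open>\<Sum>half_dual \<i> b b = 2n\<close>; here the vanishing of the trace enters. Comparison gives \<open>j = n\<close>.
\<close>
lemma pure_spinor_in_pq_fibre:
  assumes alt: "alternating \<rho>" and ann: "annihilator \<rho> = i_eigenspace (gacs_fibre J)"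
  shows "\<rho> \<in> pq_fibre J (int n) 0"
proof -
  have m: "multilinear_form \<rho>" using alt by (simp add: alternating_iff_adjacent)
  have "interior_product 0 \<rho> = 0" using interior_scale_vector[OF m, of 0 0] by simp
  then have i00: "half_interior z J 0 \<rho> = 0" for z
    by (simp add: half_interior_def blinfun.zero_right)
  have c: "half_interior (- \<i>) J v \<rho> + covector_wedge (half_covector \<i> J (\<lambda>v. complex_of_real (blinfun_apply \<xi> v))) \<rho> = 0" for v \<xi>
    using ann unfolding i_eigenspace_gacs_fibre[OF J_J] annihilator_def clifford_eigen[symmetric] by blast
  have "covector_wedge (\<lambda>v. 0) \<rho> = 0" by (simp add: covector_wedge_def fun_eq_iff)
  then have i0: "half_interior (- \<i>) J v \<rho> = 0" for v
    using c[of v 0] by (simp add: half_covector_def[abs_def] blinfun.zero_left)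
  have w0: "covector_wedge (half_dual \<i> b) \<rho> = 0" for b
    using c[of 0 "blinfun_inner_right b"] by (simp add: i00 half_dual_def blinfun_inner_right.rep_eq)
  have "\<rho> vs = 0" if "length vs \<noteq> n" for vs
  proof -
    have "covector_wedge (half_dual \<i> b) (interior_product b \<rho>) = scale_form (half_dual \<i> b b) \<rho>" for b
      using interior_covector_wedge[of b "half_dual \<i> b" \<rho>] by (simp only: w0 interior_simps) simp
    then have "(\<Sum>b\<in>B. covector_wedge (half_dual \<i> b) (interior_product b \<rho>)) =
      scale_form (\<Sum>b\<in>B. half_dual \<i> b b) \<rho>"
      by (simp only: flip: mform.scale_sum_left)
    also have "(\<Sum>b\<in>B. half_dual \<i> b b) = (\<Sum>b\<in>B. 1 - \<i> * complex_of_real (b \<bullet> J b))"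
      by (rule sum.cong) (simp_all add: half_dual_def half_covector_def unit_B)
    also have "\<dots> = 2 * of_nat n - \<i> * trace_J"
      by (simp add: sum_subtractf card_B trace_J_def sum_distrib_left)
    finally have "(\<Sum>b\<in>B. covector_wedge (half_dual \<i> b) (interior_product b \<rho>)) = scale_form (2 * of_nat n) \<rho>"
      by (simp add: trace_J_0)
    then have "2 * of_nat (length vs) * \<rho> vs = 2 * of_nat n * \<rho> vs"
      using half_dual_euler_degree[OF alt i0, of vs] by (simp only: scale_form_def)
    then show ?thesis using that by auto
  qed
  then show ?thesis by (intro pq_fibre_0I alt i0) auto
qed

lemma canonical_line_eq: "canonical_line (gacs_fibre J) = pq_fibre J (int n) 0"
proof
  show "canonical_line (gacs_fibre J) \<subseteq> pq_fibre J (int n) 0"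
    unfolding canonical_line_def
    by (rule cspan_subspaceI) (auto intro: pure_spinor_in_pq_fibre subspace_pq_fibre)
  show "pq_fibre J (int n) 0 \<subseteq> canonical_line (gacs_fibre J)"
  proof
    fix \<phi> assume \<phi>: "\<phi> \<in> pq_fibre J (int n) 0"
    show "\<phi> \<in> canonical_line (gacs_fibre J)"
    proof (cases "\<phi> = 0")
      case True then show ?thesis by (simp add: canonical_line_def mform.subspace_0[OF subspace_cspan])
    next
      case False
      then show ?thesis using annihilator_eq[OF \<phi>] alternating_pq_fibre[OF \<phi>]
        by (auto simp: canonical_line_def cspan_eq_span intro: mform.span_base)
    qed
  qed
qed

lemma U_fibre_subset: "U_fibre n (gacs_fibre J) k \<subseteq> cspan (\<Union>p. pq_fibre J p (p - k))"
proof (cases "k \<le> int n")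
  case False then show ?thesis by (simp add: U_fibre_def mform.subspace_0[OF subspace_cspan])
next
  case True
  have step: "clifford w \<phi> \<in> cspan (\<Union>p. pq_fibre J p (p - (k - 1)))"
    if w: "w \<in> cconj ` i_eigenspace (gacs_fibre J)" and \<phi>: "\<phi> \<in> cspan (\<Union>p. pq_fibre J p (p - k))" for w \<phi> k
  proof (rule form_linear_cspan[OF form_linear_clifford _ subspace_cspan \<phi>])
    fix \<psi> assume "\<psi> \<in> (\<Union>p. pq_fibre J p (p - k))"
    then obtain p where \<psi>: "\<psi> \<in> pq_fibre J p (p - k)" by blast
    obtain v \<xi> where w_eq: "w = ((v, \<xi>), (- J v, \<xi> o\<^sub>L J))" using w unfolding cconj_i_eigenspace by blast
    have "half_interior \<i> J v \<psi> \<in> pq_fibre J (p - 1) ((p - 1) - (k - 1))"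
      using pq_fibre_half_interior_10[OF \<psi>, of v] by simp
    moreover have "covector_wedge (half_covector (- \<i>) J (\<lambda>v. complex_of_real (\<xi> v))) \<psi> \<in> pq_fibre J p (p - (k - 1))"
      using pq_fibre_wedge_01[OF eigen_half_blinfun \<psi>, of \<xi>] by (simp add: algebra_simps)
    ultimately show "clifford w \<psi> \<in> cspan (\<Union>p. pq_fibre J p (p - (k - 1)))"
      unfolding w_eq clifford_conj_eigen[OF alternating_pq_fibre[OF \<psi>]]
      unfolding cspan_eq_span by (blast intro: mform.span_add mform.span_base)
  qed
  have "foldr clifford ws \<rho> \<in> cspan (\<Union>p. pq_fibre J p (p - (int n - int (length ws))))"
    if "set ws \<subseteq> cconj ` i_eigenspace (gacs_fibre J)" "\<rho> \<in> canonical_line (gacs_fibre J)" for ws \<rho>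
    using that
  proof (induction ws)
    case Nil
    then have "\<rho> \<in> pq_fibre J (int n) (int n - int n)" by (simp add: canonical_line_eq)
    then have "\<rho> \<in> cspan (\<Union>p. pq_fibre J p (p - int n))"
      unfolding cspan_eq_span by (blast intro: mform.span_base)
    then show ?case by simp
  next
    case (Cons w ws)
    then show ?case using step[of w "foldr clifford ws \<rho>" "int n - int (length ws)"]
      by (simp add: algebra_simps)
  qed
  from this True show ?thesis
    unfolding U_fibre_def
    by (intro if_P[THEN ord_eq_le_trans] cspan_subspaceI subspace_cspan) fastforce+
qed

text \<open>
  Induction on the number \<open>(n - p) + q\<close> of steps from type \<open>(n,0)\<close>. For \<open>q > 0\<close> the equation
  \<open>half_euler (-\<i>) \<phi> = 4q\<phi>\<close> writes \<open>\<phi>\<close> as a sum of wedge products of covectors of type \<open>(0,1)\<close> with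
  forms of type \<open>(p, q - 1)\<close>. For \<open>q = 0\<close> and \<open>p < n\<close>, the identity \<open>half_euler_10_dual\<close> writes
  \<open>4(n - p)\<phi>\<close> as a sum of contractions of forms of type \<open>(p + 1, 0)\<close> with vectors of type \<open>(1,0)\<close>.
  Both operations belong to the action of the conjugate of \<open>L\<close>.
\<close>
lemma pq_fibre_subset_U_fibre: "pq_fibre J p q \<subseteq> U_fibre n (gacs_fibre J) (p - q)"
proof (cases "p > int n \<or> q < 0")
  case True
  then show ?thesis using mform.subspace_0[OF subspace_U_fibre]
    by (auto simp: pq_fibre_large_p pq_fibre_negative)
next
  case False
  then show ?thesis
  proof (induction "nat (int n - p) + nat q" arbitrary: p q rule: less_induct)
    case less
    show ?case
    proof
      fix \<phi> assume \<phi>: "\<phi> \<in> pq_fibre J p q"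
      consider "q > 0" | "q = 0" "p < int n" | "q = 0" "p = int n" using less.prems by linarith
      then show "\<phi> \<in> U_fibre n (gacs_fibre J) (p - q)"
      proof cases
        case 1
        have "covector_wedge (half_dual (- \<i>) b) (half_interior (- \<i>) J b \<phi>) \<in> U_fibre n (gacs_fibre J) (p - q)" for b
        proof -
          let ?\<psi> = "half_interior (- \<i>) J b \<phi>" and ?w = "((0, blinfun_inner_right b), (- J 0, blinfun_inner_right b o\<^sub>L J))"
          have "?\<psi> \<in> pq_fibre J p (q - 1)" by (rule pq_fibre_half_interior_01[OF \<phi>])
          then have "?\<psi> \<in> U_fibre n (gacs_fibre J) (p - (q - 1))"
            using less.hyps[of p "q - 1"] less.prems 1 by auto
          then have "clifford ?w ?\<psi> \<in> U_fibre n (gacs_fibre J) (p - q)"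
            by (intro U_fibre_clifford) (simp add: algebra_simps, unfold cconj_i_eigenspace, blast)
          moreover have alt: "alternating ?\<psi>" by (intro alternating_half_interior alternating_pq_fibre[OF \<phi>])
          moreover have "half_interior z J 0 ?\<psi> = 0" for z
            using interior_scale_vector[of ?\<psi> 0 0] alt
            by (simp add: alternating_iff_adjacent half_interior_def[of z J 0] blinfun.zero_right)
          ultimately show ?thesis
            by (simp only: clifford_conj_eigen half_dual_def blinfun_inner_right.rep_eq) simp
        qed
        then have "half_euler (- \<i>) \<phi> \<in> U_fibre n (gacs_fibre J) (p - q)"
          unfolding half_euler_def by (intro mform.subspace_sum[OF subspace_U_fibre])
        then have "scale_form (4 * of_int q) \<phi> \<in> U_fibre n (gacs_fibre J) (p - q)"
          by (simp add: half_euler_01[OF \<phi>])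
        from mform.subspace_scale[OF subspace_U_fibre this, of "1 / (4 * of_int q)"] 1
        show ?thesis by simp
      next
        case 2
        have "half_interior \<i> J b (covector_wedge (half_dual \<i> b) \<phi>) \<in> U_fibre n (gacs_fibre J) (p - q)" for b
        proof -
          let ?\<psi> = "covector_wedge (half_dual \<i> b) \<phi>" and ?w = "((b, 0), (- J b, 0 o\<^sub>L J))"
          have \<psi>: "?\<psi> \<in> pq_fibre J (p + 1) q" by (rule pq_fibre_wedge_10[OF eigen_half_dual \<phi>]) simp
          then have "?\<psi> \<in> U_fibre n (gacs_fibre J) (p + 1 - q)"
            using less.hyps[of "p + 1" q] less.prems 2 by auto
          then have "clifford ?w ?\<psi> \<in> U_fibre n (gacs_fibre J) (p - q)"
            by (intro U_fibre_clifford) (simp add: algebra_simps, unfold cconj_i_eigenspace, blast)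
          moreover have "covector_wedge (half_covector (- \<i>) J (\<lambda>v. complex_of_real (blinfun_apply 0 v))) ?\<psi> = 0"
            by (simp add: covector_wedge_def[of "half_covector _ _ _"] half_covector_def blinfun.zero_left fun_eq_iff)
          ultimately show ?thesis
            by (simp only: clifford_conj_eigen[OF alternating_pq_fibre[OF \<psi>]] add_0_right)
        qed
        then have "(\<Sum>b\<in>B. half_interior \<i> J b (covector_wedge (half_dual \<i> b) \<phi>)) \<in> U_fibre n (gacs_fibre J) (p - q)"
          by (intro mform.subspace_sum[OF subspace_U_fibre])
        then have "scale_form (4 * (of_nat n - of_int p)) \<phi> \<in> U_fibre n (gacs_fibre J) (p - q)"
          by (simp add: half_euler_10_dual[OF \<phi>] trace_J_0)
        from mform.subspace_scale[OF subspace_U_fibre this, of "1 / (4 * (of_nat n - of_int p))"]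
        moreover have "of_nat n \<noteq> (of_int p :: complex)"
          using 2 by (metis less_irrefl of_int_eq_iff of_int_of_nat_eq)
        ultimately show ?thesis by simp
      next
        case 3
        then have "\<phi> \<in> canonical_line (gacs_fibre J)" using \<phi> canonical_line_eq by simp
        then have "\<phi> \<in> {foldr clifford ws \<rho> | ws \<rho>.
             length ws = nat (int n - int n) \<and> set ws \<subseteq> cconj ` i_eigenspace (gacs_fibre J) \<and>
             \<rho> \<in> canonical_line (gacs_fibre J)}"
          by (intro CollectI exI[of _ "[]"] exI[of _ \<phi>]) auto
        then show ?thesis using 3 by (simp add: U_fibre_def cspan_eq_span mform.span_base)
      qed
    qed
  qed
qed

text \<open>
  The summands lie in the different degrees \<open>2p - k\<close>; so the sum is direct, and its terms are
  recovered as the components of fixed degree.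
\<close>
theorem U_fibre_gacs_fibre:
  "U_fibre n (gacs_fibre J) k = cspan (\<Union>p. pq_fibre J p (p - k))"
proof
  have "pq_fibre J p (p - k) \<subseteq> U_fibre n (gacs_fibre J) k" for p
    using pq_fibre_subset_U_fibre[of p "p - k"] by simp
  then show "cspan (\<Union>p. pq_fibre J p (p - k)) \<subseteq> U_fibre n (gacs_fibre J) k"
    by (intro cspan_subspaceI subspace_U_fibre) blast
qed (rule U_fibre_subset)

end

section \<open>Direct sum decompositions of quotients\<close>

text \<open>
  The cohomology spaces enter only through their additive groups, so that cosets of subgroups
  suffice.
\<close>
definition add_subgroup :: "'g::ab_group_add set \<Rightarrow> bool" where
  "add_subgroup S \<longleftrightarrow> 0 \<in> S \<and> (\<forall>x\<in>S. \<forall>y\<in>S. x - y \<in> S)"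

lemma add_subgroup_0: "add_subgroup S \<Longrightarrow> 0 \<in> S"
  by (simp add: add_subgroup_def)

lemma add_subgroup_diff: "add_subgroup S \<Longrightarrow> x \<in> S \<Longrightarrow> y \<in> S \<Longrightarrow> x - y \<in> S"
  by (simp add: add_subgroup_def)

lemma add_subgroup_minus: "add_subgroup S \<Longrightarrow> x \<in> S \<Longrightarrow> - x \<in> S"
  using add_subgroup_diff[of S 0 x] add_subgroup_0[of S] by simp

lemma add_subgroup_add: "add_subgroup S \<Longrightarrow> x \<in> S \<Longrightarrow> y \<in> S \<Longrightarrow> x + y \<in> S"
  using add_subgroup_diff[of S x "- y"] add_subgroup_minus[of S y] by simp

lemma add_subgroup_sum: "add_subgroup S \<Longrightarrow> (\<And>i. i \<in> I \<Longrightarrow> f i \<in> S) \<Longrightarrow> sum f I \<in> S"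
  by (induction I rule: infinite_finite_induct) (auto simp: add_subgroup_0 add_subgroup_add)

lemma coset_eq_iff:
  assumes "add_subgroup W" shows "x +o W = y +o W \<longleftrightarrow> x - y \<in> W"
proof
  assume "x +o W = y +o W"
  then have "x \<in> y +o W" using set_plus_intro2[OF add_subgroup_0[OF assms], of x] by simp
  then show "x - y \<in> W" by (rule set_plus_imp_minus)
next
  have *: "x +o W \<subseteq> y +o W" if "x - y \<in> W" for x y
  proof
    fix z assume "z \<in> x +o W"
    then have "z - x \<in> W" by (rule set_plus_imp_minus)
    from add_subgroup_add[OF assms this that] show "z \<in> y +o W" by (simp flip: set_minus_plus)
  qed
  assume "x - y \<in> W"
  with add_subgroup_minus[OF assms this] show "x +o W = y +o W" using *[of x y] *[of y x] by auto
qed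

lemma coset_eq_self_iff: "add_subgroup W \<Longrightarrow> x +o W = W \<longleftrightarrow> x \<in> W"
  using coset_eq_iff[of W x 0] by simp

lemma subgroup_plus_self: "add_subgroup W \<Longrightarrow> W + W = (W :: 'g::ab_group_add set)"
  using add_subgroup_0[of W] add_subgroup_add[of W] set_zero_plus2[of W W] by (auto elim!: set_plus_elim)

lemma coset_add: "add_subgroup W \<Longrightarrow> (x +o W) + (y +o W) = (x + y) +o W"
  by (simp only: set_plus_rearrange subgroup_plus_self)

text \<open>
  The images of the subgroups \<open>S i\<close> in the quotient of \<open>V\<close> by \<open>W\<close> form an internal direct sum, expressed
  by representatives: the first conjunct says that they span, the second that they are independent.
\<close>
definition splits ::
  "'g::ab_group_add set \<Rightarrow> 'g set \<Rightarrow> 'i set \<Rightarrow> ('i \<Rightarrow> 'g set) \<Rightarrow> bool" where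
  "splits V W I S \<longleftrightarrow>
     (\<forall>\<alpha>\<in>V. \<exists>F a. finite F \<and> F \<subseteq> I \<and> (\<forall>i\<in>F. a i \<in> S i) \<and> \<alpha> - sum a F \<in> W) \<and>
     (\<forall>F a. finite F \<longrightarrow> F \<subseteq> I \<longrightarrow> (\<forall>i\<in>F. a i \<in> S i) \<longrightarrow> sum a F \<in> W \<longrightarrow> (\<forall>i\<in>F. a i \<in> W))"

lemma quotient_space_simps:
  "carrier (quotient_space V W) = {\<alpha> +o W | \<alpha>. \<alpha> \<in> V}"
  "add (quotient_space V W) = (+)" "\<zero>\<^bsub>quotient_space V W\<^esub> = W"
  by (simp_all add: quotient_space_def)

lemma abelian_monoid_quotient_space:
  assumes V: "add_subgroup V" and W: "add_subgroup W"
  shows "abelian_monoid (quotient_space V W)"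
proof (rule abelian_monoidI)
  show "x \<oplus>\<^bsub>quotient_space V W\<^esub> y \<in> carrier (quotient_space V W)"
    if "x \<in> carrier (quotient_space V W)" "y \<in> carrier (quotient_space V W)" for x y
    using that add_subgroup_add[OF V] by (auto simp: quotient_space_simps coset_add[OF W])
  show "\<zero>\<^bsub>quotient_space V W\<^esub> \<in> carrier (quotient_space V W)"
    using add_subgroup_0[OF V] by (auto simp: quotient_space_simps intro!: exI[of _ 0])
  show "\<zero>\<^bsub>quotient_space V W\<^esub> \<oplus>\<^bsub>quotient_space V W\<^esub> x = x" if "x \<in> carrier (quotient_space V W)" for x
  proof -
    obtain \<alpha> where "x = \<alpha> +o W" using \<open>x \<in> carrier (quotient_space V W)\<close> by (auto simp: quotient_space_simps)
    then show ?thesis using coset_add[OF W, of 0 \<alpha>] by (simp add: quotient_space_simps)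
  qed
qed (simp_all only: quotient_space_simps ac_simps)

text \<open>
  The sum over the support of \<open>s\<close> may be computed over any larger finite set \<open>G\<close>, where representatives
  in \<open>W\<close> may occur; this allows two families with different supports to be compared.
\<close>
lemma finsum_quotient_space:
  assumes V: "add_subgroup V" and W: "add_subgroup W"
    and G: "finite G" "G \<subseteq> I" "{i\<in>I. s i \<noteq> W} \<subseteq> G"
    and a: "\<And>i. i \<in> I \<Longrightarrow> a i \<in> V" "\<And>i. i \<in> I \<Longrightarrow> s i = a i +o W"
  shows "finsum (quotient_space V W) s {i\<in>I. s i \<noteq> W} = sum a G +o W"
proof -
  interpret abelian_monoid "quotient_space V W" by (rule abelian_monoid_quotient_space[OF V W])
  have *: "finsum (quotient_space V W) s F = sum a F +o W" if "finite F" "F \<subseteq> I" for F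
    using that
  proof (induction F rule: finite_induct)
    case empty show ?case
      by (simp only: finsum_empty sum.empty quotient_space_simps set_zero_plus)
  next
    case (insert x F)
    have "s i \<in> carrier (quotient_space V W)" if "i \<in> I" for i
      using a that by (auto simp: quotient_space_simps)
    then have "finsum (quotient_space V W) s (insert x F) = s x + finsum (quotient_space V W) s F"
      using insert.hyps insert.prems by (subst finsum_insert) (auto simp: quotient_space_simps(2))
    also have "\<dots> = (a x +o W) + (sum a F +o W)"
      using insert.IH insert.prems a(2)[of x] by simp
    finally show ?case by (simp only: coset_add[OF W] sum.insert[OF insert.hyps])
  qed
  have "sum a G - sum a {i\<in>I. s i \<noteq> W} = sum a (G - {i\<in>I. s i \<noteq> W})"
    using G by (subst sum_diff) auto
  also have "\<dots> \<in> W"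
    using G a(2) coset_eq_self_iff[OF W] by (intro add_subgroup_sum[OF W]) auto
  finally have "sum a G - sum a {i\<in>I. s i \<noteq> W} \<in> W" .
  then have "sum a G +o W = sum a {i\<in>I. s i \<noteq> W} +o W" by (simp add: coset_eq_iff[OF W])
  moreover have "finite {i\<in>I. s i \<noteq> W}" "{i\<in>I. s i \<noteq> W} \<subseteq> I" using G finite_subset by auto
  note *[OF this]
  ultimately show ?thesis by simp
qed

lemma internal_direct_sum_quotient_space_iff:
  assumes V: "add_subgroup V" and W: "add_subgroup W"
    and S: "\<And>i. i \<in> I \<Longrightarrow> add_subgroup (S i)" "\<And>i. i \<in> I \<Longrightarrow> S i \<subseteq> V"
  shows "internal_direct_sum (quotient_space V W) I (\<lambda>i. {\<alpha> +o W | \<alpha>. \<alpha> \<in> S i}) \<longleftrightarrow> splits V W I S"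
    (is "?ids \<longleftrightarrow> _")
proof -
  let ?M = "quotient_space V W" and ?C = "\<lambda>i. {\<alpha> +o W | \<alpha>. \<alpha> \<in> S i}"
  \<comment> \<open>\<open>s\<close> is one of the families that the definition of an internal direct sum requires to be unique.\<close>
  define represents where "represents m s \<longleftrightarrow> s \<in> Pi\<^sub>E I ?C \<and> finite {i\<in>I. s i \<noteq> W} \<and>
        m = finsum ?M s {i\<in>I. s i \<noteq> W}" for m s
  have ids: "?ids \<longleftrightarrow> (\<forall>\<alpha>\<in>V. \<exists>!s. represents (\<alpha> +o W) s)"
  proof -
    have "carrier ?M = (\<lambda>\<alpha>. \<alpha> +o W) ` V" by (auto simp: quotient_space_simps)
    moreover have "\<forall>i\<in>I. ?C i \<subseteq> carrier ?M" using S(2) by (auto simp: quotient_space_simps)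
    ultimately show ?thesis
      unfolding internal_direct_sum_def represents_def by (simp add: quotient_space_simps(3))
  qed
  have lift: "represents (sum a F +o W) (\<lambda>i\<in>I. (if i \<in> F then a i else 0) +o W)"
    if F: "finite F" "F \<subseteq> I" and a: "\<forall>i\<in>F. a i \<in> S i" for F a
  proof -
    let ?s = "\<lambda>i\<in>I. (if i \<in> F then a i else 0) +o W" and ?a = "\<lambda>i. if i \<in> F then a i else 0"
    have sub: "{i\<in>I. ?s i \<noteq> W} \<subseteq> F" by (auto simp: restrict_def)
    have mem: "?a i \<in> S i" if "i \<in> I" for i using a add_subgroup_0[OF S(1)[OF that]] by auto
    have PiE: "?s \<in> Pi\<^sub>E I ?C" using mem by (auto simp: restrict_def PiE_def extensional_def)
    have aV: "?a i \<in> V" if "i \<in> I" for i using mem[OF that] S(2)[OF that] by blast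
    have sa: "?s i = ?a i +o W" if "i \<in> I" for i using that by (rule restrict_apply')
    have "finsum ?M ?s {i\<in>I. ?s i \<noteq> W} = sum ?a F +o W"
      by (rule finsum_quotient_space[OF V W F sub aV sa])
    moreover have "sum ?a F = sum a F" by (rule sum.cong) auto
    ultimately show ?thesis unfolding represents_def using PiE finite_subset[OF sub F(1)] by simp
  qed
  have rep: "\<exists>a. (\<forall>i\<in>I. a i \<in> S i \<and> s i = a i +o W) \<and>
      (\<forall>G. finite G \<longrightarrow> G \<subseteq> I \<longrightarrow> {i\<in>I. s i \<noteq> W} \<subseteq> G \<longrightarrow> m = sum a G +o W)"
    if "represents m s" for m s
  proof -
    have "\<forall>i\<in>I. \<exists>\<alpha>. \<alpha> \<in> S i \<and> s i = \<alpha> +o W"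
      using that by (fastforce simp: represents_def PiE_def Pi_def)
    then obtain a where a: "\<forall>i\<in>I. a i \<in> S i \<and> s i = a i +o W" by metis
    have "m = sum a G +o W" if "finite G" "G \<subseteq> I" "{i\<in>I. s i \<noteq> W} \<subseteq> G" for G
      using finsum_quotient_space[OF V W that, of a] a S(2) \<open>represents m s\<close>
      by (auto simp: represents_def)
    with a show ?thesis by blast
  qed
  show ?thesis
  proof
    assume ?ids
    then have ex1: "\<exists>!s. represents (\<alpha> +o W) s" if "\<alpha> \<in> V" for \<alpha> using ids that by blast
    show "splits V W I S"
      unfolding splits_def
    proof (intro conjI ballI allI impI)
      fix \<alpha> assume "\<alpha> \<in> V"
      then obtain s where s: "represents (\<alpha> +o W) s" using ex1 by blast
      let ?F = "{i\<in>I. s i \<noteq> W}"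
      have F: "finite ?F" "?F \<subseteq> I" using s by (auto simp: represents_def)
      obtain a where "\<forall>i\<in>I. a i \<in> S i \<and> s i = a i +o W" "\<alpha> +o W = sum a ?F +o W"
        using rep[OF s] F by (metis (no_types, lifting) subset_refl)
      then show "\<exists>F a. finite F \<and> F \<subseteq> I \<and> (\<forall>i\<in>F. a i \<in> S i) \<and> \<alpha> - sum a F \<in> W"
        using F by (intro exI[of _ ?F] exI[of _ a]) (auto simp: coset_eq_iff[OF W])
    next
      fix F a i assume F: "finite F" "F \<subseteq> I" "\<forall>i\<in>F. a i \<in> S i" and sum: "sum a F \<in> W" and i: "i \<in> F"
      have "represents (0 +o W) (\<lambda>i\<in>I. (if i \<in> F then a i else 0) +o W)"
      proof -
        have "sum a F +o W = 0 +o W" using coset_eq_self_iff[OF W] sum set_zero_plus by metis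
        then show ?thesis using lift[OF F] by (simp only:)
      qed
      moreover have "represents (0 +o W) (\<lambda>i\<in>I. (if i \<in> {} then a i else 0) +o W)"
        using lift[of "{}" a] by simp
      ultimately have "(\<lambda>i\<in>I. (if i \<in> F then a i else 0) +o W) = (\<lambda>i\<in>I. (if i \<in> {} then a i else 0) +o W)"
        using ex1[OF add_subgroup_0[OF V]] by blast
      from fun_cong[OF this, of i] have "a i +o W = W" using i F by auto
      then show "a i \<in> W" by (simp add: coset_eq_self_iff[OF W])
    qed
  next
    assume sp: "splits V W I S"
    show ?ids
      unfolding ids
    proof (intro ballI ex_ex1I)
      fix \<alpha> assume "\<alpha> \<in> V"
      from conjunct1[OF sp[unfolded splits_def], THEN bspec, OF this]
      obtain F a where F: "finite F" "F \<subseteq> I" "\<forall>i\<in>F. a i \<in> S i" "\<alpha> - sum a F \<in> W"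
        by (elim exE conjE)
      then have "\<alpha> +o W = sum a F +o W" by (simp add: coset_eq_iff[OF W])
      then show "\<exists>s. represents (\<alpha> +o W) s" using lift[OF F(1-3)] by auto
    next
      fix \<alpha> s t assume "\<alpha> \<in> V" and s: "represents (\<alpha> +o W) s" and t: "represents (\<alpha> +o W) t"
      let ?G = "{i\<in>I. s i \<noteq> W} \<union> {i\<in>I. t i \<noteq> W}"
      have G: "finite ?G" "?G \<subseteq> I" using s t by (auto simp: represents_def)
      from rep[OF s] obtain a where a1: "\<forall>i\<in>I. a i \<in> S i \<and> s i = a i +o W"
        and a2: "\<forall>G. finite G \<longrightarrow> G \<subseteq> I \<longrightarrow> {i\<in>I. s i \<noteq> W} \<subseteq> G \<longrightarrow> \<alpha> +o W = sum a G +o W"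
        by (elim exE conjE)
      note a = a1 a2[rule_format, OF G Un_upper1]
      from rep[OF t] obtain b where b1: "\<forall>i\<in>I. b i \<in> S i \<and> t i = b i +o W"
        and b2: "\<forall>G. finite G \<longrightarrow> G \<subseteq> I \<longrightarrow> {i\<in>I. t i \<noteq> W} \<subseteq> G \<longrightarrow> \<alpha> +o W = sum b G +o W"
        by (elim exE conjE)
      note b = b1 b2[rule_format, OF G Un_upper2]
      have "sum (\<lambda>i. a i - b i) ?G \<in> W"
        unfolding sum_subtractf coset_eq_iff[OF W, symmetric] by (rule trans[OF a(2)[symmetric] b(2)])
      moreover have "\<forall>i\<in>?G. a i - b i \<in> S i"
        using G a(1) b(1) by (auto intro: add_subgroup_diff[OF S(1)])
      ultimately have "\<forall>i\<in>?G. a i - b i \<in> W"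
        using conjunct2[OF sp[unfolded splits_def], THEN spec, THEN spec,
            THEN mp, OF G(1), THEN mp, OF G(2), of "\<lambda>i. a i - b i"] by simp
      then have "s i = t i" if "i \<in> I" for i
        using that a(1) b(1) coset_eq_iff[OF W] by (cases "i \<in> ?G") auto
      moreover have "s \<in> extensional I" "t \<in> extensional I"
        using s t by (auto simp: represents_def PiE_def)
      ultimately show "s = t" by (intro extensionalityI) auto
    qed
  qed
qed

section \<open>From the grading by p - q to the grading by degree\<close>

text \<open>
  Here \<open>\<pi> j\<close> is the projection to degree \<open>j\<close>, and \<open>T p q\<close> is the part of \<open>S (p - q)\<close> in degree \<open>p + q\<close>. In
  a fixed degree \<open>j\<close> the pairs \<open>(p,q)\<close> correspond to the integers \<open>p - q\<close> of the same parity as \<open>j\<close>. So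
  applying \<open>\<pi> j\<close> to a sum along \<open>S\<close> gives a sum along \<open>T\<close> with the same number of terms or fewer, and
  summing over \<open>j\<close> restores the original one. Spanning and independence are carried over in both
  directions by these two operations.
\<close>
lemma bigraded_splits_iff:
  fixes \<pi> :: "int \<Rightarrow> 'g::ab_group_add \<Rightarrow> 'g" and S :: "int \<Rightarrow> 'g set" and T :: "int \<Rightarrow> int \<Rightarrow> 'g set"
  assumes Z: "add_subgroup Z" and W: "add_subgroup W" and S: "\<And>k. add_subgroup (S k)"
    and N: "finite N" "\<And>x. x \<in> Z \<Longrightarrow> x = (\<Sum>j\<in>N. \<pi> j x)"
    and \<pi>: "\<And>j x y. \<pi> j (x + y) = \<pi> j x + \<pi> j y" "\<And>j x. \<pi> j (\<pi> j x) = \<pi> j x"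
    and \<pi>_Z: "\<And>j x. x \<in> Z \<Longrightarrow> \<pi> j x \<in> Z" and \<pi>_W: "\<And>j x. x \<in> W \<Longrightarrow> \<pi> j x \<in> W"
    and S_Z: "\<And>k. S k \<subseteq> Z"
    and S_T: "\<And>p q x. x \<in> S (p - q) \<Longrightarrow> \<pi> (p + q) x \<in> T p q"
    and S_odd: "\<And>j k x. x \<in> S k \<Longrightarrow> odd (j + k) \<Longrightarrow> \<pi> j x = 0"
    and T_S: "\<And>p q. T p q \<subseteq> S (p - q)" and T_\<pi>: "\<And>p q x. x \<in> T p q \<Longrightarrow> \<pi> (p + q) x = x"
  shows "splits Z W UNIV S \<longleftrightarrow>
    (\<forall>j. splits {x\<in>Z. \<pi> j x = x} {x\<in>W. \<pi> j x = x} {(p, q). p + q = j} (\<lambda>(p, q). T p q))"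
    (is "_ \<longleftrightarrow> (\<forall>j. splits (?Z j) (?W j) (?I j) ?T)")
proof -
  have \<pi>0: "\<pi> j 0 = 0" for j using \<pi>(1)[of j 0 0] by simp
  have \<pi>m: "\<pi> j (- x) = - \<pi> j x" for j x
    using \<pi>(1)[of j x "- x"] by (simp add: \<pi>0 eq_neg_iff_add_eq_0 add.commute)
  have \<pi>d: "\<pi> j (x - y) = \<pi> j x - \<pi> j y" for j x y
    using \<pi>(1)[of j x "- y"] by (simp add: \<pi>m)
  have \<pi>s: "\<pi> j (sum f F) = (\<Sum>i\<in>F. \<pi> j (f i))" for j F and f :: "'z \<Rightarrow> 'g"
    by (induction F rule: infinite_finite_induct) (simp_all add: \<pi>0 \<pi>)
  define lift where "lift j i = ((j + i) div 2, (j - i) div 2)" for j i :: int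
  have lift: "lift (p + q) (p - q) = (p, q)" for p q by (simp add: lift_def)
  \<comment> \<open>the pairs \<open>(p,q)\<close> with \<open>p + q = j\<close> and \<open>p - q \<in> F\<close>\<close>
  define parts where "parts j F = lift j ` {i\<in>F. even (j + i)}" for j F
  have E: "fst (lift j i) + snd (lift j i) = j" "fst (lift j i) - snd (lift j i) = i"
    if "even (j + i)" for i j
    using that by (auto simp: lift_def elim!: evenE) presburger+
  have parts_I: "parts j F \<subseteq> ?I j" for j F
    using E by (auto simp: parts_def case_prod_unfold)
  have parts_T: "\<forall>x\<in>parts j F. (case x of (p, q) \<Rightarrow> \<pi> j (a (p - q))) \<in> ?T x"
    if a: "\<forall>i\<in>F. a i \<in> S i" for j F a
  proof
    fix x assume x: "x \<in> parts j F"
    obtain p q where pq: "x = (p, q)" by force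
    obtain i where i: "i \<in> F" "even (j + i)" "(p, q) = lift j i"
      using x unfolding pq parts_def by blast
    from E[OF i(2)] i(3) have "p + q = j" "p - q = i" by (metis fst_conv snd_conv)+
    then show "(case x of (p, q) \<Rightarrow> \<pi> j (a (p - q))) \<in> ?T x" using S_T[of "a i" p q] a i(1) pq by simp
  qed
  have parts_sum: "\<pi> j (sum a F) = (\<Sum>(p, q)\<in>parts j F. \<pi> j (a (p - q)))"
    if F: "finite F" "\<forall>i\<in>F. a i \<in> S i" for F a j
  proof -
    let ?E = "{i\<in>F. even (j + i)}"
    have inj: "inj_on (lift j) ?E"
      by (rule inj_on_inverseI[where g = "\<lambda>x. fst x - snd x"]) (use E in auto)
    have "\<pi> j (sum a F) = (\<Sum>i\<in>F. \<pi> j (a i))" by (rule \<pi>s)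
    also have "\<dots> = (\<Sum>i\<in>?E. \<pi> j (a i))"
      using F S_odd by (intro sum.mono_neutral_right) auto
    also have "\<dots> = (\<Sum>(p, q)\<in>parts j F. \<pi> j (a (p - q)))"
      unfolding sum.reindex[OF inj] parts_def using E by (intro sum.cong) (auto simp: case_prod_unfold)
    finally show ?thesis .
  qed
  show ?thesis
  proof (intro iffI allI)
    fix j assume sp: "splits Z W UNIV S"
    show "splits (?Z j) (?W j) (?I j) ?T"
      unfolding splits_def
    proof (intro conjI ballI allI impI)
      fix \<alpha> assume \<alpha>: "\<alpha> \<in> ?Z j"
      then obtain F a where F: "finite F" "\<forall>i\<in>F. a i \<in> S i" "\<alpha> - sum a F \<in> W"
        using sp unfolding splits_def by blast
      let ?F' = "parts j F" and ?a' = "\<lambda>(p, q). \<pi> j (a (p - q))"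
      have "\<alpha> - sum ?a' ?F' = \<pi> j (\<alpha> - sum a F)"
        using \<alpha> by (simp add: \<pi>d parts_sum[OF F(1,2)])
      also have "\<dots> \<in> ?W j" using \<pi>_W[OF F(3)] \<pi>(2) by simp
      finally show "\<exists>F a. finite F \<and> F \<subseteq> ?I j \<and> (\<forall>i\<in>F. a i \<in> ?T i) \<and> \<alpha> - sum a F \<in> ?W j"
        using parts_I[of j F] parts_T[OF F(2), of j] F(1)
        by (intro exI[of _ ?F'] exI[of _ ?a']) (simp add: parts_def)
    next
      fix F a pq assume F: "finite F" "F \<subseteq> ?I j" "\<forall>i\<in>F. a i \<in> ?T i" and sum: "sum a F \<in> ?W j"
        and pq: "pq \<in> F"
      let ?d = "\<lambda>(p, q). p - q :: int"
      have l: "lift j (?d i) = i" if "i \<in> F" for i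
        using that F(2) by (auto simp: lift[symmetric])
      have inj: "inj_on ?d F" by (metis (no_types, lifting) l inj_onI)
      have "sum (\<lambda>i. a (lift j i)) (?d ` F) = sum a F"
        unfolding sum.reindex[OF inj] by (rule sum.cong) (use l in auto)
      moreover have "\<forall>i\<in>?d ` F. a (lift j i) \<in> S i"
      proof
        fix i assume "i \<in> ?d ` F"
        then obtain p q where "(p, q) \<in> F" "i = p - q" by auto
        moreover have "lift j i = (p, q)" using l[of "(p, q)"] calculation by simp
        ultimately show "a (lift j i) \<in> S i" using F(3) T_S by fastforce
      qed
      moreover have "finite (?d ` F)" using F(1) by (rule finite_imageI)
      moreover have "sum a F \<in> W" using sum by simp
      ultimately have "\<forall>i\<in>?d ` F. a (lift j i) \<in> W"
        using conjunct2[OF sp[unfolded splits_def], rule_format, of "?d ` F" "\<lambda>i. a (lift j i)"] by auto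
      then have "a pq \<in> W" using l[OF pq] pq by (metis imageI)
      moreover have "\<pi> j (a pq) = a pq" using pq F(2,3) T_\<pi> by fastforce
      ultimately show "a pq \<in> ?W j" by simp
    qed
  next
    assume sp: "\<forall>j. splits (?Z j) (?W j) (?I j) ?T"
    show "splits Z W UNIV S"
      unfolding splits_def
    proof (intro conjI ballI allI impI)
      fix \<alpha> assume \<alpha>: "\<alpha> \<in> Z"
      have "\<forall>j. \<exists>F a. finite F \<and> F \<subseteq> ?I j \<and> (\<forall>i\<in>F. a i \<in> ?T i) \<and> \<pi> j \<alpha> - sum a F \<in> ?W j"
      proof
        fix j
        have "\<pi> j \<alpha> \<in> ?Z j" using \<pi>_Z[OF \<alpha>] \<pi>(2) by simp
        with sp[rule_format, of j, unfolded splits_def, THEN conjunct1]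
        show "\<exists>F a. finite F \<and> F \<subseteq> ?I j \<and> (\<forall>i\<in>F. a i \<in> ?T i) \<and> \<pi> j \<alpha> - sum a F \<in> ?W j"
          by (rule bspec)
      qed
      then obtain F a where F: "\<And>j. finite (F j)" "\<And>j. F j \<subseteq> ?I j"
        "\<And>j i. i \<in> F j \<Longrightarrow> a j i \<in> ?T i" "\<And>j. \<pi> j \<alpha> - sum (a j) (F j) \<in> ?W j"
        unfolding choice_iff by blast
      \<comment> \<open>The pieces found in the single degrees are collected according to \<open>p - q\<close>.\<close>
      let ?P = "Sigma N F" and ?d = "\<lambda>(j :: int, (p, q)). p - q :: int"
      let ?b = "\<lambda>k. \<Sum>(j, i)\<in>{x\<in>?P. ?d x = k}. a j i"
      have P: "finite ?P" using N F(1) by auto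
      have "sum ?b (?d ` ?P) = (\<Sum>(j, i)\<in>?P. a j i)"
        using P by (subst sum.group) auto
      also have "\<dots> = (\<Sum>j\<in>N. sum (a j) (F j))"
        using N F(1) by (subst sum.Sigma) auto
      finally have "\<alpha> - sum ?b (?d ` ?P) = (\<Sum>j\<in>N. \<pi> j \<alpha> - sum (a j) (F j))"
        using N(2)[OF \<alpha>] by (simp add: sum_subtractf)
      also have "\<dots> \<in> W" using F(4) by (intro add_subgroup_sum[OF W]) auto
      finally have "\<alpha> - sum ?b (?d ` ?P) \<in> W" .
      moreover have "\<forall>k\<in>?d ` ?P. ?b k \<in> S k"
      proof
        fix k
        have "a j i \<in> S k" if "(j, i) \<in> ?P" "?d (j, i) = k" for j i
          using that F(3)[of i j] T_S by (cases i) auto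
        then show "?b k \<in> S k" by (intro add_subgroup_sum[OF S]) auto
      qed
      ultimately show "\<exists>F a. finite F \<and> F \<subseteq> UNIV \<and> (\<forall>i\<in>F. a i \<in> S i) \<and> \<alpha> - sum a F \<in> W"
        using P by (intro exI[of _ "?d ` ?P"] exI[of _ ?b]) auto
    next
      fix F a i assume F: "finite F" "\<forall>i\<in>F. a i \<in> S i" and sum: "sum a F \<in> W" and i: "i \<in> F"
      have "\<pi> j (a i) \<in> W" for j
      proof (cases "even (j + i)")
        case False
        then have "\<pi> j (a i) = 0" using S_odd F(2) i by blast
        then show ?thesis by (simp add: add_subgroup_0[OF W])
      next
        case True
        let ?F' = "parts j F" and ?a' = "\<lambda>(p, q). \<pi> j (a (p - q))"
        have "sum ?a' ?F' \<in> ?W j"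
          using \<pi>_W[OF sum, of j] \<pi>(2)[of j "sum a F"] by (simp flip: parts_sum[OF F])
        moreover have "finite ?F'" using F(1) by (simp add: parts_def)
        ultimately have "\<forall>x\<in>?F'. ?a' x \<in> ?W j"
          using conjunct2[OF sp[rule_format, of j, unfolded splits_def], rule_format, OF _ parts_I]
            parts_T[OF F(2), of j] by blast
        then have "?a' (lift j i) \<in> W" using i True by (simp add: parts_def)
        then show ?thesis using E[OF True] by (simp add: case_prod_unfold)
      qed
      then have "(\<Sum>j\<in>N. \<pi> j (a i)) \<in> W" by (intro add_subgroup_sum[OF W])
      moreover have "a i \<in> Z" using F(2) i S_Z by blast
      ultimately show "a i \<in> W" using N(2) by simp
    qed
  qed
qed

section \<open>Differential forms and their components of fixed degree\<close>

lemma Ck_on_const: "Ck_on k S (\<lambda>x. c)"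
  by (induction k arbitrary: c) auto

lemma Ck_on_diff:
  assumes "open S" "Ck_on k S f" "Ck_on k S g"
  shows "Ck_on k S (\<lambda>x. f x - g x)"
  using assms(2,3)
proof (induction k arbitrary: f g)
  case 0 then show ?case by (simp add: continuous_on_diff)
next
  case (Suc k)
  have d: "((\<lambda>x. f x - g x) has_derivative
      (\<lambda>v. frechet_derivative f (at x) v - frechet_derivative g (at x) v)) (at x)" if "x \<in> S" for x
    using Suc.prems that by (intro has_derivative_diff) (simp_all flip: frechet_derivative_works)
  have "Ck_on k S (\<lambda>x. frechet_derivative (\<lambda>x. f x - g x) (at x) v)" for v
  proof (rule Ck_on_cong[OF assms(1)])
    show "frechet_derivative f (at x) v - frechet_derivative g (at x) v =
        frechet_derivative (\<lambda>x. f x - g x) (at x) v" if "x \<in> S" for x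
      using fun_cong[OF frechet_derivative_at[OF d[OF that]], of v] .
    show "Ck_on k S (\<lambda>x. frechet_derivative f (at x) v - frechet_derivative g (at x) v)"
      using Suc.prems by (intro Suc.IH) simp_all
  qed
  with d show ?case by (auto simp: differentiable_def)
qed

lemma smooth_on_imp_differentiable: "smooth_on S f \<Longrightarrow> x \<in> S \<Longrightarrow> f differentiable (at x)"
  unfolding smooth_on_def by (metis Ck_on.simps(2))

lemma alternating_0: "alternating 0"
  using mform.subspace_0[OF alternating_subspace] by simp

lemma alternating_diff: "alternating \<phi> \<Longrightarrow> alternating \<psi> \<Longrightarrow> alternating (\<phi> - \<psi>)"
  using mform.subspace_diff[OF alternating_subspace] by (metis mem_Collect_eq)

definition degree_part :: "int \<Rightarrow> 'e mform \<Rightarrow> 'e mform" where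
  "degree_part k \<phi> vs = (if int (length vs) = k then \<phi> vs else 0)"

definition form_degree_part :: "int \<Rightarrow> ('a, 'e) form_field \<Rightarrow> ('a, 'e) form_field" where
  "form_degree_part k \<omega> = (\<lambda>c x. degree_part k (\<omega> c x))"

lemma form_linear_degree_part: "form_linear (degree_part k)"
  by (rule form_linearI) (auto simp: degree_part_def scale_form_def fun_eq_iff)

lemma degree_part_pq_fibre:
  assumes "\<phi> \<in> pq_fibre J p q"
  shows "degree_part j \<phi> = (if j = p + q then \<phi> else 0)"
  using homogeneous_pq_fibre[OF assms] by (auto simp: degree_part_def fun_eq_iff)

lemma alternating_degree_part:
  assumes "alternating \<phi>" shows "alternating (degree_part k \<phi>)"
  unfolding alternating_def
proof (intro conjI allI impI)
  show "linear (\<lambda>v. degree_part k \<phi> (us @ v # ws))" for us ws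
    using assms by (cases "int (length us + length ws) + 1 = k")
      (auto simp: alternating_def degree_part_def add.commute module_hom_zero)
  show "degree_part k \<phi> vs = 0" if "\<not> distinct vs" for vs
    using assms that by (auto simp: alternating_def degree_part_def)
qed

text \<open>Among the types with a given \<open>p - q\<close>, only \<open>(p0, q0)\<close> has degree \<open>p0 + q0\<close>.\<close>
lemma degree_part_pq_sum:
  assumes "\<phi> \<in> cspan (\<Union>p. pq_fibre J p (p - (p0 - q0)))"
  shows "degree_part (p0 + q0) \<phi> \<in> pq_fibre J p0 q0"
proof (rule form_linear_cspan[OF form_linear_degree_part _ subspace_pq_fibre assms])
  fix \<psi> assume "\<psi> \<in> (\<Union>p. pq_fibre J p (p - (p0 - q0)))"
  then obtain p where \<psi>: "\<psi> \<in> pq_fibre J p (p - (p0 - q0))" by blast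
  show "degree_part (p0 + q0) \<psi> \<in> pq_fibre J p0 q0"
  proof (cases "p = p0")
    case True then show ?thesis using \<psi> by (simp add: degree_part_pq_fibre[OF \<psi>])
  next
    case False then show ?thesis by (simp add: degree_part_pq_fibre[OF \<psi>] pq_fibre_0)
  qed
qed

lemma degree_part_pq_sum_odd:
  assumes "\<phi> \<in> cspan (\<Union>p. pq_fibre J p (p - k))" "odd (j + k)"
  shows "degree_part j \<phi> = 0"
proof -
  have "degree_part j \<phi> \<in> {0}"
  proof (rule form_linear_cspan[OF form_linear_degree_part _ mform.subspace_single_0 assms(1)])
    fix \<psi> assume "\<psi> \<in> (\<Union>p. pq_fibre J p (p - k))"
    then obtain p where \<psi>: "\<psi> \<in> pq_fibre J p (p - k)" by blast
    have "j \<noteq> p + (p - k)" using assms(2) by presburger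
    then show "degree_part j \<psi> \<in> {0}" by (simp add: degree_part_pq_fibre[OF \<psi>])
  qed
  then show ?thesis by simp
qed

text \<open>
  Gram-Schmidt gives an orthogonal spanning set; without zero it is a basis, hence has \<open>2n\<close>
  elements.
\<close>
lemma exists_linear_complex_structure:
  fixes J :: "'e::real_inner \<Rightarrow>\<^sub>L 'e" and B :: "'e set"
  assumes B: "finite B" "independent B" "span B = UNIV" "card B = 2 * n"
    and J: "J o\<^sub>L J = - id_blinfun"
  shows "\<exists>B'. linear_complex_structure J B' n"
proof -
  obtain C :: "'e set" where C: "finite C" "span C = UNIV" "pairwise orthogonal C"
    using basis_orthogonal[OF B(1)] B(3) by metis
  define C0 where "C0 = C - {0}"
  have C0: "finite C0" "pairwise orthogonal C0" "0 \<notin> C0" "span C0 = UNIV"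
    using C by (auto simp: C0_def pairwise_def span_delete_0)
  have indep: "independent C0" using pairwise_orthogonal_independent[OF C0(2,3)] .
  have "card C0 = 2 * n"
  proof -
    have "dim (UNIV :: 'e set) = card C0" by (rule real_vector.dim_eq_card) (simp_all add: C0(4) indep)
    moreover have "dim (UNIV :: 'e set) = card B" by (rule real_vector.dim_eq_card) (simp_all add: B)
    ultimately show ?thesis using B(4) by simp
  qed
  define B' where "B' = sgn ` C0"
  have norm: "sgn b \<bullet> sgn b = 1" if "b \<in> C0" for b
    using that C0(3) by (metis dot_square_norm norm_sgn one_power2)
  have orth: "sgn b \<bullet> sgn c = 0" if "b \<in> C0" "c \<in> C0" "b \<noteq> c" for b c
    using that C0(2) by (simp add: pairwise_def orthogonal_def sgn_div_norm)
  have inj: "inj_on sgn C0" using norm orth by (metis inj_onI zero_neq_one)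
  show ?thesis
  proof (intro exI[of _ B'] linear_complex_structure.intro)
    show "J (J v) = - v" for v
      by (metis J blinfun_apply_blinfun_compose blinfun.minus_left id_blinfun.rep_eq id_apply)
    show "finite B'" using C0 by (simp add: B'_def)
    show "card B' = 2 * n" using \<open>card C0 = 2 * n\<close> card_image[OF inj] by (simp add: B'_def)
    show "b \<bullet> b = 1" if "b \<in> B'" for b using that norm by (auto simp: B'_def)
    show "v = (\<Sum>b\<in>B'. (b \<bullet> v) *\<^sub>R b)" for v
    proof -
      define w where "w = v - (\<Sum>b\<in>B'. (b \<bullet> v) *\<^sub>R b)"
      have "sgn c \<bullet> w = 0" if c: "c \<in> C0" for c
      proof -
        have "sgn c \<bullet> (\<Sum>b\<in>B'. (b \<bullet> v) *\<^sub>R b) = (\<Sum>b\<in>C0. (sgn b \<bullet> v) * (sgn c \<bullet> sgn b))"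
          unfolding B'_def sum.reindex[OF inj] by (simp add: inner_sum_right)
        also have "\<dots> = (\<Sum>b\<in>C0. if b = c then sgn c \<bullet> v else 0)"
          by (rule sum.cong) (use c norm orth in auto)
        finally show ?thesis using c C0(1) by (simp add: w_def inner_diff_right)
      qed
      then have "c \<bullet> w = 0" if "c \<in> C0" for c
        using that C0(3) by (auto simp: sgn_div_norm)
      then have "C0 \<subseteq> {c. c \<bullet> w = 0}" by auto
      moreover have "subspace {c. c \<bullet> w = 0}"
        by (auto simp: subspace_def inner_add_left)
      ultimately have "span C0 \<subseteq> {c. c \<bullet> w = 0}" by (rule span_minimal)
      then have "w \<bullet> w = 0" unfolding C0(4) by blast
      then show ?thesis by (simp add: w_def)
    qed
  qed
qed

lemma form_degree_part_forms:
  assumes "\<omega> \<in> forms A" shows "form_degree_part k \<omega> \<in> forms A"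
proof -
  have "smooth_on S (\<lambda>x. degree_part k (\<omega> c x) vs)" if "smooth_on S (\<lambda>x. \<omega> c x vs)" for S c vs
    using that by (cases "int (length vs) = k") (simp_all add: degree_part_def smooth_on_def Ck_on_const)
  moreover have "degree_part k 0 = 0" by (rule module_hom.zero[OF form_linear_degree_part])
  ultimately show ?thesis
    using assms by (auto simp: forms_def form_degree_part_def alternating_degree_part degree_part_def)
qed

lemma forms_of_degree_eq: "forms_of_degree A k = {\<omega>\<in>forms A. form_degree_part k \<omega> = \<omega>}"
proof -
  have "form_degree_part k \<omega> = \<omega> \<longleftrightarrow> (\<forall>c x vs. int (length vs) \<noteq> k \<longrightarrow> \<omega> c x vs = 0)" for \<omega> :: "('a, 'b) form_field"
    by (auto simp: form_degree_part_def degree_part_def fun_eq_iff)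
  then show ?thesis by (auto simp: forms_of_degree_def)
qed

text \<open>
  At a list of vectors of the wrong length, only derivatives of the zero function occur.
\<close>
lemma ext_deriv_form_degree_part:
  "ext_deriv A (form_degree_part k \<omega>) = form_degree_part (k + 1) (ext_deriv A \<omega>)"
  for \<omega> :: "('a, 'b::real_normed_vector) form_field"
proof (intro ext)
  fix c x and vs :: "'b list"
  have l: "length (omit_nth i vs) = length vs - 1" if "i < length vs" for i
    using that by (simp add: omit_nth_def)
  show "ext_deriv A (form_degree_part k \<omega>) c x vs = form_degree_part (k + 1) (ext_deriv A \<omega>) c x vs"
  proof (cases "int (length vs) = k + 1")
    case True
    then show ?thesis using l
      by (auto simp: ext_deriv_def form_degree_part_def degree_part_def intro!: sum.cong)
  next
    case False
    then have "int (length (omit_nth i vs)) \<noteq> k" if "i < length vs" for i using that l by simp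
    then show ?thesis using False
      by (simp add: ext_deriv_def form_degree_part_def degree_part_def)
  qed
qed

locale open_charts =
  fixes A :: "('a, 'e::real_normed_vector) chart set"
  assumes open_chart_image: "c \<in> A \<Longrightarrow> open (chart_image c)"
begin

lemma add_subgroup_forms: "add_subgroup (forms A)"
  unfolding add_subgroup_def
proof (intro conjI ballI)
  show "0 \<in> forms A"
    by (simp add: forms_def smooth_on_def Ck_on_const alternating_0)
  fix \<omega> \<eta> assume "\<omega> \<in> forms A" "\<eta> \<in> forms A"
  then show "\<omega> - \<eta> \<in> forms A"
    by (auto simp: forms_def smooth_on_def intro: Ck_on_diff open_chart_image alternating_diff)
qed

lemma ext_deriv_diff:
  assumes "\<omega> \<in> forms A" "\<eta> \<in> forms A"
  shows "ext_deriv A (\<omega> - \<eta>) = ext_deriv A \<omega> - ext_deriv A \<eta>"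
proof (intro ext)
  fix c x vs
  show "ext_deriv A (\<omega> - \<eta>) c x vs = (ext_deriv A \<omega> - ext_deriv A \<eta>) c x vs"
  proof (cases "c \<in> A \<and> x \<in> chart_image c")
    case True
    have "frechet_derivative (\<lambda>y. \<omega> c y us - \<eta> c y us) (at x) v =
        frechet_derivative (\<lambda>y. \<omega> c y us) (at x) v - frechet_derivative (\<lambda>y. \<eta> c y us) (at x) v" for us v
    proof -
      have d: "(\<lambda>y. \<omega> c y us) differentiable (at x)" "(\<lambda>y. \<eta> c y us) differentiable (at x)"
        using True assms by (auto simp: forms_def intro!: smooth_on_imp_differentiable[of "chart_image c"])
      from has_derivative_diff[OF d[unfolded frechet_derivative_works]]
      show ?thesis by (simp flip: frechet_derivative_at)
    qed
    then show ?thesis using True by (simp add: ext_deriv_def sum_subtractf right_diff_distrib)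
  qed (auto simp: ext_deriv_def)
qed

lemma ext_deriv_0: "ext_deriv A 0 = 0"
  using ext_deriv_diff[of 0 0] add_subgroup_0[OF add_subgroup_forms] by simp

lemma add_subgroup_closed:
  assumes "add_subgroup S" "S \<subseteq> forms A"
  shows "add_subgroup {\<omega>\<in>S. ext_deriv A \<omega> = 0}"
  using assms ext_deriv_diff unfolding add_subgroup_def by (auto simp: ext_deriv_0 subset_iff)

lemma add_subgroup_exact:
  assumes "add_subgroup S" "S \<subseteq> forms A"
  shows "add_subgroup (ext_deriv A ` S)"
  unfolding add_subgroup_def
proof (intro conjI ballI)
  show "0 \<in> ext_deriv A ` S" using add_subgroup_0[OF assms(1)] ext_deriv_0 by (metis imageI)
  fix \<omega> \<eta> assume "\<omega> \<in> ext_deriv A ` S" "\<eta> \<in> ext_deriv A ` S"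
  then obtain \<alpha> \<beta> where *: "\<omega> = ext_deriv A \<alpha>" "\<eta> = ext_deriv A \<beta>" "\<alpha> \<in> S" "\<beta> \<in> S" by blast
  have "\<omega> - \<eta> = ext_deriv A (\<alpha> - \<beta>)"
    unfolding *(1,2) by (rule ext_deriv_diff[symmetric]) (use * assms(2) in blast)+
  then show "\<omega> - \<eta> \<in> ext_deriv A ` S"
    by (rule image_eqI[where f = "ext_deriv A" and x = "\<alpha> - \<beta>"]) (rule add_subgroup_diff[OF assms(1) *(3,4)])
qed

lemma add_subgroup_fibrewise:
  assumes "\<And>c x. mform.subspace (S c x)"
  shows "add_subgroup {\<omega>\<in>forms A. \<forall>c\<in>A. \<forall>x\<in>chart_image c. \<omega> c x \<in> S c x}"
  using add_subgroup_forms mform.subspace_diff[OF assms] mform.subspace_0[OF assms]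
  by (auto simp: add_subgroup_def)

lemma add_subgroup_forms_of_degree: "add_subgroup (forms_of_degree A k)"
  using add_subgroup_forms by (auto simp: add_subgroup_def forms_of_degree_def)

end

lemma form_degree_part_add:
  "form_degree_part k (\<omega> + \<eta>) = form_degree_part k \<omega> + form_degree_part k \<eta>"
  by (auto simp: form_degree_part_def degree_part_def fun_eq_iff)

lemma form_degree_part_0: "form_degree_part k 0 = 0"
  by (auto simp: form_degree_part_def degree_part_def fun_eq_iff)

lemma form_degree_part_idem: "form_degree_part k (form_degree_part k \<omega>) = form_degree_part k \<omega>"
  by (auto simp: form_degree_part_def degree_part_def fun_eq_iff)

lemma internal_direct_sum_cong:
  assumes "\<And>i. i \<in> I \<Longrightarrow> S i = S' i"
  shows "internal_direct_sum M I S = internal_direct_sum M I S'"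
proof -
  have "Pi\<^sub>E I S = Pi\<^sub>E I S'" using assms by (rule PiE_cong)
  then show ?thesis unfolding internal_direct_sum_def using assms by simp
qed

lemma form_degree_part_sum:
  assumes "\<omega> \<in> forms A" "\<And>c x vs. c \<in> A \<Longrightarrow> x \<in> chart_image c \<Longrightarrow> length vs > m \<Longrightarrow> \<omega> c x vs = 0"
  shows "\<omega> = (\<Sum>j\<in>{0..int m}. form_degree_part j \<omega>)"
proof (intro ext)
  fix c x vs
  have "\<omega> c x vs = 0" if "\<not> int (length vs) \<le> int m"
  proof (cases "c \<in> A \<and> x \<in> chart_image c")
    case True then show ?thesis using that assms(2) by simp
  next
    case False
    then have "\<omega> c x = 0" using assms(1) unfolding forms_def by blast
    then show ?thesis by simp
  qed
  moreover have "(\<Sum>j\<in>{0..int m}. form_degree_part j \<omega>) c x vs =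
      (\<Sum>j\<in>{0..int m}. if j = int (length vs) then \<omega> c x vs else 0)"
    by (simp add: sum_form_apply form_degree_part_def degree_part_def eq_commute)
  ultimately show "\<omega> c x vs = (\<Sum>j\<in>{0..int m}. form_degree_part j \<omega>) c x vs" by simp
qed

section \<open>Pure-and-fullness of an almost-complex structure\<close>

theorem proposition2p9:
  fixes X :: "'a topology"
    and A :: "('a, 'e::real_inner) chart set"
    and n :: nat
    and J :: "('a, 'e) chart \<Rightarrow> 'e \<Rightarrow> 'e \<Rightarrow>\<^sub>L 'e"
  assumes "smooth_manifold X A (2 * n)"
    and "compact_space X"
    and "almost_complex_structure A J"
  shows "gacs_pure_and_full n A (gacs_of J) \<longleftrightarrow> (\<forall>k::int. complex_pure_and_full_at_stage A J k)"
proof -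
  interpret open_charts A
    using assms(1) by unfold_locales (auto simp: smooth_manifold_def)
  let ?d = "ext_deriv A" and ?\<pi> = form_degree_part
  define Z where "Z = {\<omega>\<in>forms A. ?d \<omega> = 0}"
  define W where "W = ?d ` forms A"
  define S where "S k = {\<omega>\<in>U_forms n A (gacs_of J) k. ?d \<omega> = 0}" for k
  define T where "T p q = {\<omega>\<in>pq_forms A J p q. ?d \<omega> = 0}" for p q
  \<comment> \<open>The fibres of the tangent bundle are complex vector spaces to which the linear algebra applies.\<close>
  have fibre: "\<exists>B. linear_complex_structure (J c x) B n" if "c \<in> A" "x \<in> chart_image c" for c x
  proof -
    have "J c x o\<^sub>L J c x = - id_blinfun"
      using assms(3) that by (auto simp: almost_complex_structure_def)
    then show ?thesis
      using assms(1) exists_linear_complex_structure unfolding smooth_manifold_def by metis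
  qed
  have U: "U_fibre n (gacs_of J c x) k = cspan (\<Union>p. pq_fibre (J c x) p (p - k))"
    if "c \<in> A" "x \<in> chart_image c" for c x k
    using fibre[OF that] linear_complex_structure.U_fibre_gacs_fibre unfolding gacs_of_def by blast
  have Z: "add_subgroup Z" unfolding Z_def by (intro add_subgroup_closed add_subgroup_forms) simp
  have W: "add_subgroup W" unfolding W_def by (intro add_subgroup_exact add_subgroup_forms) simp
  have S: "add_subgroup (S k)" for k
    unfolding S_def U_forms_def
    by (intro add_subgroup_closed add_subgroup_fibrewise subspace_U_fibre) blast
  have T: "add_subgroup (T p q)" for p q
    unfolding T_def pq_forms_def
    by (intro add_subgroup_closed add_subgroup_fibrewise subspace_pq_fibre) blast
  have S_Z: "S k \<subseteq> Z" for k by (auto simp: S_def Z_def U_forms_def)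
  have \<pi>_closed: "?d (?\<pi> j \<omega>) = 0" if "?d \<omega> = 0" for j \<omega>
    by (simp only: ext_deriv_form_degree_part that form_degree_part_0)
  have \<pi>_Z: "?\<pi> j \<omega> \<in> Z" if "\<omega> \<in> Z" for j \<omega>
    using that form_degree_part_forms \<pi>_closed by (auto simp: Z_def)
  have d_\<pi>: "?\<pi> j (?d \<omega>) = ?d (?\<pi> (j - 1) \<omega>)" for j \<omega>
    by (simp add: ext_deriv_form_degree_part)
  have \<pi>_W: "?\<pi> j \<omega> \<in> W" if "\<omega> \<in> W" for j \<omega>
    using that form_degree_part_forms unfolding W_def by (force simp: d_\<pi>)
  have sum: "\<omega> = (\<Sum>j\<in>{0..int (2 * n)}. ?\<pi> j \<omega>)" if "\<omega> \<in> Z" for \<omega>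
  proof (rule form_degree_part_sum)
    show "\<omega> \<in> forms A" using that by (simp add: Z_def)
    show "\<omega> c x vs = 0" if c: "c \<in> A" "x \<in> chart_image c" "2 * n < length vs" for c x vs
    proof -
      obtain B where "linear_complex_structure (J c x) B n" using fibre c by blast
      then interpret linear_complex_structure "J c x" B n .
      have "alternating (\<omega> c x)" using \<open>\<omega> \<in> forms A\<close> c by (simp add: forms_def)
      then show ?thesis using alternating_vanishes c(3) card_B by simp
    qed
  qed
  have S_T: "?\<pi> (p + q) \<omega> \<in> T p q" if "\<omega> \<in> S (p - q)" for p q \<omega>
  proof -
    have "?\<pi> (p + q) \<omega> \<in> forms A" "?d (?\<pi> (p + q) \<omega>) = 0"
      using that form_degree_part_forms \<pi>_closed by (auto simp: S_def U_forms_def)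
    moreover have "?\<pi> (p + q) \<omega> c x \<in> pq_fibre (J c x) p q" if c: "c \<in> A" "x \<in> chart_image c" for c x
      using \<open>\<omega> \<in> S (p - q)\<close> c U[OF c] degree_part_pq_sum
      unfolding S_def U_forms_def form_degree_part_def by blast
    ultimately show ?thesis by (simp add: T_def pq_forms_def)
  qed
  have S_odd: "?\<pi> j \<omega> = 0" if "\<omega> \<in> S k" "odd (j + k)" for j k \<omega>
  proof (intro ext)
    fix c x vs
    have "degree_part j (\<omega> c x) = 0"
    proof (cases "c \<in> A \<and> x \<in> chart_image c")
      case True
      then have "\<omega> c x \<in> cspan (\<Union>p. pq_fibre (J c x) p (p - k))"
        using that(1) U unfolding S_def U_forms_def by blast
      then show ?thesis using that(2) by (rule degree_part_pq_sum_odd)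
    next
      case False
      then have "\<omega> c x = 0" using that(1) unfolding S_def U_forms_def forms_def by blast
      then show ?thesis using module_hom.zero[OF form_linear_degree_part] by simp
    qed
    then show "?\<pi> j \<omega> c x vs = 0 c x vs" by (simp add: form_degree_part_def)
  qed
  have T_S: "T p q \<subseteq> S (p - q)" for p q
  proof
    fix \<omega> assume "\<omega> \<in> T p q"
    moreover have "pq_fibre (J c x) p q \<subseteq> U_fibre n (gacs_of J c x) (p - q)" if "c \<in> A" "x \<in> chart_image c" for c x
      using fibre[OF that] linear_complex_structure.pq_fibre_subset_U_fibre unfolding gacs_of_def by blast
    ultimately show "\<omega> \<in> S (p - q)" unfolding S_def T_def U_forms_def pq_forms_def by blast
  qed
  have T_\<pi>: "?\<pi> (p + q) \<omega> = \<omega>" if "\<omega> \<in> T p q" for p q \<omega>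
  proof (intro ext)
    fix c x vs
    show "?\<pi> (p + q) \<omega> c x vs = \<omega> c x vs"
    proof (cases "c \<in> A \<and> x \<in> chart_image c")
      case True
      then have "\<omega> c x \<in> pq_fibre (J c x) p q" using that by (auto simp: T_def pq_forms_def)
      then show ?thesis by (simp add: form_degree_part_def degree_part_pq_fibre)
    next
      case False
      then have "\<omega> c x = 0" using that unfolding T_def pq_forms_def forms_def by blast
      then show ?thesis by (simp add: form_degree_part_def degree_part_def)
    qed
  qed
  \<comment> \<open>Closed and exact forms of degree \<open>k\<close> are the closed and exact mixed forms fixed by \<open>\<pi> k\<close>.\<close>
  have Zk: "{\<omega>\<in>forms_of_degree A k. ?d \<omega> = 0} = {\<omega>\<in>Z. ?\<pi> k \<omega> = \<omega>}" for k
    by (auto simp: Z_def forms_of_degree_eq)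
  have Wk: "?d ` forms_of_degree A (k - 1) = {\<omega>\<in>W. ?\<pi> k \<omega> = \<omega>}" for k
  proof (intro equalityI subsetI)
    fix \<omega> assume "\<omega> \<in> ?d ` forms_of_degree A (k - 1)"
    then show "\<omega> \<in> {\<omega>\<in>W. ?\<pi> k \<omega> = \<omega>}" by (auto simp: W_def forms_of_degree_eq d_\<pi>)
  next
    fix \<omega> assume "\<omega> \<in> {\<omega>\<in>W. ?\<pi> k \<omega> = \<omega>}"
    then obtain \<eta> where "\<eta> \<in> forms A" "\<omega> = ?d (?\<pi> (k - 1) \<eta>)" by (auto simp: W_def d_\<pi>)
    then show "\<omega> \<in> ?d ` forms_of_degree A (k - 1)"
      by (auto simp: forms_of_degree_eq form_degree_part_forms form_degree_part_idem)
  qed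
  have "gacs_pure_and_full n A (gacs_of J) \<longleftrightarrow> splits Z W UNIV S"
  proof -
    have "GH_J n A (gacs_of J) = (\<lambda>k. {\<alpha> +o W | \<alpha>. \<alpha> \<in> S k})"
      by (rule ext) (simp add: GH_J_def S_def W_def)
    then show ?thesis
      using internal_direct_sum_quotient_space_iff[OF Z W S S_Z, of UNIV]
      by (simp add: gacs_pure_and_full_def GH_dR_def Z_def W_def)
  qed
  also have "\<dots> \<longleftrightarrow> (\<forall>k. splits {\<omega>\<in>Z. ?\<pi> k \<omega> = \<omega>} {\<omega>\<in>W. ?\<pi> k \<omega> = \<omega>} {(p, q). p + q = k} (\<lambda>(p, q). T p q))"
    by (rule bigraded_splits_iff[OF Z W S _ sum form_degree_part_add form_degree_part_idem \<pi>_Z \<pi>_W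
        S_Z S_T S_odd T_S T_\<pi>]) simp_all
  also have "\<dots> \<longleftrightarrow> (\<forall>k. complex_pure_and_full_at_stage A J k)"
  proof (intro all_cong1)
    fix k
    let ?Z = "{\<omega>\<in>forms_of_degree A k. ?d \<omega> = 0}" and ?W = "?d ` forms_of_degree A (k - 1)"
      and ?I = "{(p, q). p + q = k}" and ?T = "\<lambda>(p, q). T p q"
    have sub: "forms_of_degree A j \<subseteq> forms A" for j by (auto simp: forms_of_degree_def)
    have "complex_pure_and_full_at_stage A J k \<longleftrightarrow>
        internal_direct_sum (quotient_space ?Z ?W) ?I (\<lambda>i. {\<alpha> +o ?W | \<alpha>. \<alpha> \<in> ?T i})"
      unfolding complex_pure_and_full_at_stage_def H_dR_def
      by (rule internal_direct_sum_cong) (auto simp: H_J_def T_def)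
    also have "\<dots> \<longleftrightarrow> splits ?Z ?W ?I ?T"
    proof (rule internal_direct_sum_quotient_space_iff)
      show "add_subgroup ?Z" by (intro add_subgroup_closed add_subgroup_forms_of_degree sub)
      show "add_subgroup ?W" by (intro add_subgroup_exact add_subgroup_forms_of_degree sub)
      show "add_subgroup (?T i)" for i using T by (cases i) simp
      show "?T i \<subseteq> ?Z" if "i \<in> ?I" for i
        using that T_S S_Z T_\<pi> unfolding Zk by (cases i) fastforce
    qed
    finally show "splits {\<omega>\<in>Z. ?\<pi> k \<omega> = \<omega>} {\<omega>\<in>W. ?\<pi> k \<omega> = \<omega>} ?I ?T \<longleftrightarrow>
        complex_pure_and_full_at_stage A J k"
      unfolding Zk Wk by simp
  qed
  finally show ?thesis .
qed

end
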